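(* Let $E_1,\ldots,E_m,F$ be Riesz spaces with $E_1,\ldots,E_m$ Archimedean, let $\rho\in S_m$ and let $A\colon E_1\times\cdots\times E_m\longrightarrow F$ be an $m$-linear regular operator. For $x_k''\in(E_k^\sim)_n^\sim$, $k=1,\ldots,m$, $$AR_m^\rho(A)(x_1'',\ldots,x_m'')=|\sigma|\text{-}\lim_{\alpha_{\rho(1)}}\cdots|\sigma|\text{-}\lim_{\alpha_{\rho(m)}}J_F(A(x_{\alpha_1},\ldots,x_{\alpha_m})),$$ where $(x_{\alpha_k})_{\alpha_k}$ is a net in $E_k$ such that $J_{E_k}(x_{\alpha_k})\stackrel{|\sigma|}{\longrightarrow}x_k''$ in $(E_k^\sim)_n^\sim$, $k=1,\ldots,m$.
   Context: All Riesz spaces are real and $m\in\mathbb{N}$. $E^\sim$ is the order dual of a Riesz space $E$ (the order bounded, equivalently regular, linear functionals), $E^{\sim\sim}=(E^\sim)^\sim$, and $(E^\sim)_n^\sim\subseteq E^{\sim\sim}$ is the subspace of order continuous functionals on $E^\sim$. $J_E\colon E\to E^{\sim\sim}$, $J_E(x)(x')=x'(x)$, is the canonical operator; its range lies in $(E^\sim)_n^\sim$. The topology $|\sigma|$ on $E^{\sim\sim}$ (and on its subspace $(E^\sim)_n^\sim$) is the absolute weak topology determined by $E^\sim$, generated by the seminorms $x''\mapsto|x''|(|\varphi|)$, $\varphi\in E^\sim$. It is known (Grobler) that for $E$ Archimedean every $x''\in(E^\sim)_n^\sim$ is the $|\sigma|$-limit of a net $(J_E(x_\alpha))_\alpha$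 with $x_\alpha\in E$. $S_m$ is the set of permutations of $\{1,\ldots,m\}$. An $m$-linear operator $A\colon E_1\times\cdots\times E_m\to F$ between Riesz spaces is positive if $A(x_1,\ldots,x_m)\ge 0$ whenever all $x_i\ge 0$, and regular if it is a difference of two positive $m$-linear operators; $\mathcal{L}_r(E_1,\ldots,E_m;F)$ is the space of regular $m$-linear operators. Arens extensions: fix $\rho\in S_m$. For $0\le k\le m$ let $I_k=\{1,\ldots,m\}\setminus\{\rho(1),\ldots,\rho(k)\}$ and let $\mathcal{L}^{\rho,k}$ be the space of regular $(m-k)$-linear forms on the product of the spaces $E_i$, $i\in I_k$ (in increasing order of indices), with $\mathcal{L}^{\rho,m}=\mathbb{R}$. For $1\le k\le m$ and $x''\in E_{\rho(k)}^{\sim\sim}$ define $\overline{x''}^{\rho}\colon\mathcal{L}^{\rho,k-1}\to\mathcal{L}^{\rho,k}$ by letting $\overline{x''}^{\rho}(B)\big((x_i)_{i\in I_k}\big)$ be the value of $x''$ at the functional $x_{\rho(k)}\mapsto B\big((x_i)_{i\in I_{k-1}}\big)$ in $E_{\rho(k)}^\sim$. For $A\in\mathcal{L}_r(E_1,\ldots,E_m;F)$ the Arens extension $AR_m^\rho(A)\colon E_1^{\sim\sim}\times\cdots\times E_m^{\sim\sim}\to F^{\sim\sim}$ is $$AR_m^\rho(A)(x_1'',\ldots,x_m'')(y')=\big(\overline{x_{\rho(m)}''}^{\rho}\circ\cdots\circ\overline{x_{\rho(1)}''}^{\rho}\big)(y'\circ A),\quad y'\in F^\sim.$$ *)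

theory Defs
  imports "HOL-Analysis.Analysis" "HOL-Combinatorics.Permutations"
begin

text \<open>
  Riesz spaces are formalized with explicit carriers, since a statement about
  \<open>E\<^sub>1, \<dots>, E\<^sub>m\<close> for arbitrary \<open>m\<close> needs a family \<open>E k\<close> of spaces inside one HOL type.
  The type imposes no restriction on the spaces: finitely many carriers of different
  types fit into a common (sum) type.
\<close>

record 'a riesz =
  rcarrier :: "'a set"
  radd :: "'a \<Rightarrow> 'a \<Rightarrow> 'a"
  rscale :: "real \<Rightarrow> 'a \<Rightarrow> 'a"
  rzero :: "'a"
  rle :: "'a \<Rightarrow> 'a \<Rightarrow> bool"

definition is_lub :: "'a riesz \<Rightarrow> 'a set \<Rightarrow> 'a \<Rightarrow> bool" where
  "is_lub R S z \<longleftrightarrow> z \<in> rcarrier R \<and> (\<forall>s\<in>S. rle R s z) \<and>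
     (\<forall>w\<in>rcarrier R. (\<forall>s\<in>S. rle R s w) \<longrightarrow> rle R z w)"

definition is_glb :: "'a riesz \<Rightarrow> 'a set \<Rightarrow> 'a \<Rightarrow> bool" where
  "is_glb R S z \<longleftrightarrow> z \<in> rcarrier R \<and> (\<forall>s\<in>S. rle R z s) \<and>
     (\<forall>w\<in>rcarrier R. (\<forall>s\<in>S. rle R w s) \<longrightarrow> rle R w z)"

locale riesz_space =
  fixes R :: "'a riesz"
  assumes zero_closed: "rzero R \<in> rcarrier R"
    and add_closed: "\<lbrakk>x \<in> rcarrier R; y \<in> rcarrier R\<rbrakk> \<Longrightarrow> radd R x y \<in> rcarrier R"
    and scale_closed: "x \<in> rcarrier R \<Longrightarrow> rscale R a x \<in> rcarrier R"
    and add_assoc: "\<lbrakk>x \<in> rcarrier R; y \<in> rcarrier R; z \<in> rcarrier R\<rbrakk> \<Longrightarrow>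
          radd R (radd R x y) z = radd R x (radd R y z)"
    and add_commute: "\<lbrakk>x \<in> rcarrier R; y \<in> rcarrier R\<rbrakk> \<Longrightarrow> radd R x y = radd R y x"
    and add_zero: "x \<in> rcarrier R \<Longrightarrow> radd R x (rzero R) = x"
    and add_inverse: "x \<in> rcarrier R \<Longrightarrow> \<exists>y\<in>rcarrier R. radd R x y = rzero R"
    and scale_add_right: "\<lbrakk>x \<in> rcarrier R; y \<in> rcarrier R\<rbrakk> \<Longrightarrow>
          rscale R a (radd R x y) = radd R (rscale R a x) (rscale R a y)"
    and scale_add_left: "x \<in> rcarrier R \<Longrightarrow>
          rscale R (a + b) x = radd R (rscale R a x) (rscale R b x)"
    and scale_scale: "x \<in> rcarrier R \<Longrightarrow> rscale R a (rscale R b x) = rscale R (a * b) x"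
    and scale_one: "x \<in> rcarrier R \<Longrightarrow> rscale R 1 x = x"
    and le_refl: "x \<in> rcarrier R \<Longrightarrow> rle R x x"
    and le_trans: "\<lbrakk>x \<in> rcarrier R; y \<in> rcarrier R; z \<in> rcarrier R; rle R x y; rle R y z\<rbrakk>
          \<Longrightarrow> rle R x z"
    and le_antisym: "\<lbrakk>x \<in> rcarrier R; y \<in> rcarrier R; rle R x y; rle R y x\<rbrakk> \<Longrightarrow> x = y"
    and add_mono: "\<lbrakk>x \<in> rcarrier R; y \<in> rcarrier R; z \<in> rcarrier R; rle R x y\<rbrakk> \<Longrightarrow>
          rle R (radd R x z) (radd R y z)"
    and scale_mono: "\<lbrakk>x \<in> rcarrier R; y \<in> rcarrier R; rle R x y; 0 \<le> a\<rbrakk> \<Longrightarrow>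
          rle R (rscale R a x) (rscale R a y)"
    and ex_sup: "\<lbrakk>x \<in> rcarrier R; y \<in> rcarrier R\<rbrakk> \<Longrightarrow> \<exists>z. is_lub R {x, y} z"
    and ex_inf: "\<lbrakk>x \<in> rcarrier R; y \<in> rcarrier R\<rbrakk> \<Longrightarrow> \<exists>z. is_glb R {x, y} z"

definition rminus :: "'a riesz \<Rightarrow> 'a \<Rightarrow> 'a \<Rightarrow> 'a" where
  "rminus R x y = radd R x (rscale R (- 1) y)"

definition rabs :: "'a riesz \<Rightarrow> 'a \<Rightarrow> 'a" where
  "rabs R x = (THE z. is_lub R {x, rscale R (- 1) x} z)"

definition archimedean :: "'a riesz \<Rightarrow> bool" where
  "archimedean R \<longleftrightarrow> (\<forall>x\<in>rcarrier R. rle R (rzero R) x \<longrightarrow>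
     is_glb R {rscale R (1 / real n) x | n::nat. n \<ge> 1} (rzero R))"

definition real_riesz :: "real riesz" where
  "real_riesz = \<lparr>rcarrier = UNIV, radd = (+), rscale = (*), rzero = 0, rle = (\<le>)\<rparr>"


text \<open>
  Functionals are represented by functions that are undefined outside the carrier, so that
  equality in the dual is HOL equality.
\<close>

definition linear_functional :: "'a riesz \<Rightarrow> ('a \<Rightarrow> real) \<Rightarrow> bool" where
  "linear_functional R f \<longleftrightarrow>
     (\<forall>x\<in>rcarrier R. \<forall>y\<in>rcarrier R. f (radd R x y) = f x + f y) \<and>
     (\<forall>a. \<forall>x\<in>rcarrier R. f (rscale R a x) = a * f x)"

definition order_bounded_functional :: "'a riesz \<Rightarrow> ('a \<Rightarrow> real) \<Rightarrow> bool" where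
  "order_bounded_functional R f \<longleftrightarrow>
     (\<forall>a\<in>rcarrier R. \<forall>b\<in>rcarrier R. \<exists>M. \<forall>x\<in>rcarrier R. rle R a x \<and> rle R x b \<longrightarrow> \<bar>f x\<bar> \<le> M)"

definition order_dual :: "'a riesz \<Rightarrow> ('a \<Rightarrow> real) riesz" where
  "order_dual R =
     \<lparr>rcarrier = {f \<in> extensional (rcarrier R).
                    linear_functional R f \<and> order_bounded_functional R f},
      radd = (\<lambda>f g. \<lambda>x\<in>rcarrier R. f x + g x),
      rscale = (\<lambda>a f. \<lambda>x\<in>rcarrier R. a * f x),
      rzero = (\<lambda>x\<in>rcarrier R. 0),
      rle = (\<lambda>f g. \<forall>x\<in>rcarrier R. rle R (rzero R) x \<longrightarrow> f x \<le> g x)\<rparr>"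

abbreviation order_bidual :: "'a riesz \<Rightarrow> (('a \<Rightarrow> real) \<Rightarrow> real) riesz" where
  "order_bidual R \<equiv> order_dual (order_dual R)"

definition canonical :: "'a riesz \<Rightarrow> 'a \<Rightarrow> ('a \<Rightarrow> real) \<Rightarrow> real" where
  "canonical R x = (\<lambda>f\<in>rcarrier (order_dual R). f x)"


text \<open>
  Order convergence to \<open>0\<close>, for filters instead of nets: there is a set \<open>D \<down> 0\<close> each of whose
  elements eventually dominates the absolute value.  A filter on the carrier satisfies this iff
  it is generated by the tails of some net \<open>(x\<^sub>\<alpha>)\<close> with \<open>\<bar>x\<^sub>\<alpha>\<bar> \<le> y\<^sub>\<alpha> \<down> 0\<close> (or is improper).
  Thus the functionals below are those mapping order null nets to null nets, without
  a quantification over the index types of nets.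
\<close>

definition order_null :: "'a riesz \<Rightarrow> 'a filter \<Rightarrow> bool" where
  "order_null R G \<longleftrightarrow> (\<exists>D. D \<noteq> {} \<and> D \<subseteq> rcarrier R \<and>
     (\<forall>d\<in>D. \<forall>e\<in>D. \<exists>c\<in>D. rle R c d \<and> rle R c e) \<and> is_glb R D (rzero R) \<and>
     (\<forall>d\<in>D. eventually (\<lambda>x. x \<in> rcarrier R \<and> rle R (rabs R x) d) G))"

definition order_cont_dual :: "'a riesz \<Rightarrow> ('a \<Rightarrow> real) set" where
  "order_cont_dual R = {f \<in> rcarrier (order_dual R). \<forall>G. order_null R G \<longrightarrow> (f \<longlongrightarrow> 0) G}"


text \<open>The topology \<open>\<bar>\<sigma>\<bar>\<close> on the order bidual, with the open seminorm balls as a subbase.\<close>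

definition abs_weak_topology :: "'a riesz \<Rightarrow> (('a \<Rightarrow> real) \<Rightarrow> real) topology" where
  "abs_weak_topology R = topology_generated_by
     {{v \<in> rcarrier (order_bidual R).
         rabs (order_bidual R) (rminus (order_bidual R) v u) (rabs (order_dual R) \<phi>) < \<epsilon>}
      | u \<phi> \<epsilon>. u \<in> rcarrier (order_bidual R) \<and> \<phi> \<in> rcarrier (order_dual R) \<and> \<epsilon> > 0}"


text \<open>
  Operators on \<open>\<Prod>\<^bsub>i \<in> I\<^esub> E\<^sub>i\<close> for a set \<open>I\<close> of indices are functions on the extensional
  product \<open>PiE\<close>.  For \<open>I = {}\<close> this product is the singleton of \<open>\<lambda>_. undefined\<close>, and
  the forms on it are identified with their value at this point, i.e. with a real number.
\<close>

abbreviation prod_carrier :: "nat set \<Rightarrow> (nat \<Rightarrow> 'a riesz) \<Rightarrow> (nat \<Rightarrow> 'a) set" where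
  "prod_carrier I E \<equiv> (\<Pi>\<^sub>E i\<in>I. rcarrier (E i))"

definition multilinear ::
    "nat set \<Rightarrow> (nat \<Rightarrow> 'a riesz) \<Rightarrow> 'b riesz \<Rightarrow> ((nat \<Rightarrow> 'a) \<Rightarrow> 'b) \<Rightarrow> bool" where
  "multilinear I E F A \<longleftrightarrow>
     (\<forall>x\<in>prod_carrier I E. A x \<in> rcarrier F) \<and>
     (\<forall>x\<in>prod_carrier I E. \<forall>i\<in>I.
        (\<forall>u\<in>rcarrier (E i). \<forall>v\<in>rcarrier (E i).
           A (x(i := radd (E i) u v)) = radd F (A (x(i := u))) (A (x(i := v)))) \<and>
        (\<forall>a. \<forall>u\<in>rcarrier (E i).
           A (x(i := rscale (E i) a u)) = rscale F a (A (x(i := u)))))"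

definition positive_multilinear ::
    "nat set \<Rightarrow> (nat \<Rightarrow> 'a riesz) \<Rightarrow> 'b riesz \<Rightarrow> ((nat \<Rightarrow> 'a) \<Rightarrow> 'b) \<Rightarrow> bool" where
  "positive_multilinear I E F A \<longleftrightarrow> multilinear I E F A \<and>
     (\<forall>x\<in>prod_carrier I E. (\<forall>i\<in>I. rle (E i) (rzero (E i)) (x i)) \<longrightarrow> rle F (rzero F) (A x))"

definition regular_multilinear ::
    "nat set \<Rightarrow> (nat \<Rightarrow> 'a riesz) \<Rightarrow> 'b riesz \<Rightarrow> ((nat \<Rightarrow> 'a) \<Rightarrow> 'b) \<Rightarrow> bool" where
  "regular_multilinear I E F A \<longleftrightarrow> multilinear I E F A \<and>
     (\<exists>P Q. positive_multilinear I E F P \<and> positive_multilinear I E F Q \<and>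
        (\<forall>x\<in>prod_carrier I E. A x = rminus F (P x) (Q x)))"

definition regular_forms :: "nat set \<Rightarrow> (nat \<Rightarrow> 'a riesz) \<Rightarrow> ((nat \<Rightarrow> 'a) \<Rightarrow> real) set" where
  "regular_forms I E =
     {B \<in> extensional (prod_carrier I E). regular_multilinear I E real_riesz B}"


definition arens_index :: "nat \<Rightarrow> (nat \<Rightarrow> nat) \<Rightarrow> nat \<Rightarrow> nat set" where
  "arens_index m \<rho> k = {1..m} - \<rho> ` {1..k}"

definition arens_bar ::
    "(nat \<Rightarrow> 'a riesz) \<Rightarrow> nat \<Rightarrow> (nat \<Rightarrow> nat) \<Rightarrow> nat \<Rightarrow> (('a \<Rightarrow> real) \<Rightarrow> real) \<Rightarrow>
     ((nat \<Rightarrow> 'a) \<Rightarrow> real) \<Rightarrow> (nat \<Rightarrow> 'a) \<Rightarrow> real" where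
  "arens_bar E m \<rho> k x'' =
     (\<lambda>B\<in>regular_forms (arens_index m \<rho> (k - 1)) E. \<lambda>x\<in>prod_carrier (arens_index m \<rho> k) E.
        x'' (\<lambda>t\<in>rcarrier (E (\<rho> k)). B (x(\<rho> k := t))))"

primrec arens_comp ::
    "(nat \<Rightarrow> 'a riesz) \<Rightarrow> nat \<Rightarrow> (nat \<Rightarrow> nat) \<Rightarrow> (nat \<Rightarrow> ('a \<Rightarrow> real) \<Rightarrow> real) \<Rightarrow> nat \<Rightarrow>
     ((nat \<Rightarrow> 'a) \<Rightarrow> real) \<Rightarrow> (nat \<Rightarrow> 'a) \<Rightarrow> real" where
  "arens_comp E m \<rho> x'' 0 = id"
| "arens_comp E m \<rho> x'' (Suc k) = arens_bar E m \<rho> (Suc k) (x'' (\<rho> (Suc k))) \<circ> arens_comp E m \<rho> x'' k"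

definition arens_ext ::
    "(nat \<Rightarrow> 'a riesz) \<Rightarrow> 'b riesz \<Rightarrow> nat \<Rightarrow> (nat \<Rightarrow> nat) \<Rightarrow> ((nat \<Rightarrow> 'a) \<Rightarrow> 'b) \<Rightarrow>
     (nat \<Rightarrow> ('a \<Rightarrow> real) \<Rightarrow> real) \<Rightarrow> ('b \<Rightarrow> real) \<Rightarrow> real" where
  "arens_ext E F m \<rho> A =
     (\<lambda>x''\<in>prod_carrier {1..m} (\<lambda>k. order_bidual (E k)). \<lambda>y'\<in>rcarrier (order_dual F).
        arens_comp E m \<rho> x'' m (\<lambda>x\<in>prod_carrier {1..m} E. y' (A x)) (\<lambda>_. undefined))"


definition directed_set :: "'i set \<Rightarrow> ('i \<Rightarrow> 'i \<Rightarrow> bool) \<Rightarrow> bool" where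
  "directed_set D le \<longleftrightarrow> D \<noteq> {} \<and> (\<forall>a\<in>D. le a a) \<and>
     (\<forall>a\<in>D. \<forall>b\<in>D. \<forall>c\<in>D. le a b \<longrightarrow> le b c \<longrightarrow> le a c) \<and>
     (\<forall>a\<in>D. \<forall>b\<in>D. \<exists>c\<in>D. le a c \<and> le b c)"

text \<open>Convergence of a net indexed by \<open>D\<close> is convergence along its filter of tails.\<close>

definition tail_filter :: "'i set \<Rightarrow> ('i \<Rightarrow> 'i \<Rightarrow> bool) \<Rightarrow> 'i filter" where
  "tail_filter D le = (INF d\<in>D. principal {e \<in> D. le d e})"

text \<open>
  \<open>iterated_limit T D le [j\<^sub>1, \<dots>, j\<^sub>n] g a l\<close>: all the inner limits of
  \<open>lim\<^bsub>\<alpha> j\<^sub>1\<^esub> \<cdots> lim\<^bsub>\<alpha> j\<^sub>n\<^esub> g \<alpha>\<close> exist in \<open>T\<close> for all values of the outer indices,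
  and \<open>l\<close> is the value of the outermost limit; \<open>a\<close> holds the indices already fixed.
\<close>

primrec iterated_limit ::
    "'c topology \<Rightarrow> (nat \<Rightarrow> 'i set) \<Rightarrow> (nat \<Rightarrow> 'i \<Rightarrow> 'i \<Rightarrow> bool) \<Rightarrow> nat list \<Rightarrow>
     ((nat \<Rightarrow> 'i) \<Rightarrow> 'c) \<Rightarrow> (nat \<Rightarrow> 'i) \<Rightarrow> 'c \<Rightarrow> bool" where
  "iterated_limit T D le [] g a l \<longleftrightarrow> l = g a"
| "iterated_limit T D le (j # js) g a l \<longleftrightarrow>
     (\<exists>h. (\<forall>\<alpha>\<in>D j. iterated_limit T D le js g (a(j := \<alpha>)) (h \<alpha>)) \<and>
          limitin T h l (tail_filter (D j) (le j)))"

end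

theory Submission
  imports Defs
begin

text \<open>
  By definition \<open>AR\<close> applies \<open>x''\<^bsub>\<rho>(1)\<^esub>\<close> to a form first, in the variable \<open>\<rho>(1)\<close>, whereas the iterated
  limit applies it last.  So the point is that the order of application is irrelevant:
  \<open>z (s \<mapsto> y (t \<mapsto> B t s)) = y (t \<mapsto> z (s \<mapsto> B t s))\<close> for a regular bilinear form \<open>B\<close>, when \<open>y\<close> and
  \<open>z\<close> are \<open>\<bar>\<sigma>\<bar>\<close>-limits of elements of the spaces and \<open>z\<close> is order continuous.  If \<open>\<bar>y\<bar> \<le> J t\<close> for some
  \<open>t\<close>, then both sides are \<open>\<bar>\<sigma>\<bar>\<close>-continuous in \<open>z\<close>, and they agree for \<open>z = J s\<close>.  A general \<open>y \<ge> 0\<close> is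
  truncated: \<open>(y - J t)\<^sup>+\<close> decreases to \<open>0\<close> pointwise, and so do the functionals
  \<open>s \<mapsto> (y - J t)\<^sup>+ (\<bar>B\<bar> (\<cdot>, s))\<close>, on which \<open>z\<close> therefore becomes small.

  Once \<open>x''\<^bsub>\<rho>(1)\<^esub>\<close> is the outermost functional, a single limit is immediate: the difference of the
  functionals on \<open>F\<^sup>\<sim>\<close> has the form \<open>y' \<mapsto> (J x - x'') (\<theta> y')\<close>, and it is dominated by
  \<open>y' \<mapsto> \<bar>J x - x''\<bar> (\<Theta> y')\<close> for a positive \<open>\<Theta>\<close> not depending on \<open>x\<close>.
\<close>

section \<open>Riesz spaces\<close>

text \<open>The modulus of A need not exist, as F need not be Dedekind complete, and no modulus of a
  form is constructed either. One decomposition A = P - Q is fixed, and each form is carried along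
  with a positive majorant. Applying v to the form and a functional w dominating v to the majorant
  preserves the domination. As P + Q does not depend on y', the majorants together give one positive
  functional on the dual of F, which makes the estimates uniform. The order of application is
  reversed before any limit is taken: when an inner functional varies, the outer ones see only
  varying sections, and a general element of the bidual need not pass to the limit along them. A
  reversal is a product of adjacent transpositions, so two functionals suffice, acting on sections
  of a form that the other functionals have already reduced. The order dual is shown to be a Riesz
  space again, so that facts about \<open>order_dual R\<close> hold for the bidual with
  \<open>order_dual R\<close> in place of \<open>R\<close>.\<close>

context riesz_space
begin

abbreviation cplus (infixl "\<oplus>" 65) where "x \<oplus> y \<equiv> radd R x y"
abbreviation cneg ("\<ominus> _" [81] 80) where "\<ominus> x \<equiv> rscale R (- 1) x"
abbreviation cle (infix "\<preceq>" 50) where "x \<preceq> y \<equiv> rle R x y"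
abbreviation czero ("\<zero>") where "\<zero> \<equiv> rzero R"
abbreviation "C \<equiv> rcarrier R"

lemmas closed = zero_closed add_closed scale_closed

lemma add_left_commute:
  "\<lbrakk>x \<in> C; y \<in> C; z \<in> C\<rbrakk> \<Longrightarrow> x \<oplus> (y \<oplus> z) = y \<oplus> (x \<oplus> z)"
  using add_assoc[of x y z] add_assoc[of y x z] add_commute[of x y] by simp

lemmas ac = add_assoc add_commute add_left_commute

lemma zero_add: "x \<in> C \<Longrightarrow> \<zero> \<oplus> x = x"
  using add_zero[of x] add_commute[of x \<zero>] by (simp add: zero_closed)

lemma add_left_cancel:
  assumes "x \<in> C" "y \<in> C" "z \<in> C" "x \<oplus> y = x \<oplus> z"
  shows "y = z"
proof -
  obtain w where w: "w \<in> C" "x \<oplus> w = \<zero>" using add_inverse assms by blast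
  have *: "w \<oplus> (x \<oplus> v) = v" if "v \<in> C" for v
  proof -
    have "w \<oplus> (x \<oplus> v) = (x \<oplus> w) \<oplus> v"
      using that w(1) assms(1) by (simp add: add_assoc add_left_commute[of w x])
    then show ?thesis using that w(2) by (simp add: zero_add)
  qed
  show ?thesis using *[OF assms(2)] *[OF assms(3)] unfolding assms(4) by metis
qed

lemma scale_zero_left: "x \<in> C \<Longrightarrow> rscale R 0 x = \<zero>"
  by (rule add_left_cancel[of x], simp_all add: closed add_zero,
      metis add.right_neutral scale_add_left scale_one)

lemma add_neg: "x \<in> C \<Longrightarrow> x \<oplus> \<ominus> x = \<zero>"
  
  by (metis add.right_inverse scale_add_left scale_one scale_zero_left)

lemma neg_add: "x \<in> C \<Longrightarrow> \<ominus> x \<oplus> x = \<zero>"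
  using add_neg[of x] add_commute[of x "\<ominus> x"] by (simp add: closed)

lemma neg_neg: "x \<in> C \<Longrightarrow> \<ominus> (\<ominus> x) = x"
  by (simp add: scale_scale scale_one)

lemma neg_zero: "\<ominus> \<zero> = \<zero>"
  using add_neg[of \<zero>] zero_add[of "\<ominus> \<zero>"] by (simp add: closed)

lemma scale_zero_right: "rscale R a \<zero> = \<zero>"
proof -
  have "rscale R a (rscale R 0 \<zero>) = rscale R 0 \<zero>" by (simp add: scale_scale zero_closed)
  then show ?thesis by (simp add: scale_zero_left zero_closed)
qed

lemma add_neg_cancel: "\<lbrakk>x \<in> C; y \<in> C\<rbrakk> \<Longrightarrow> (x \<oplus> y) \<oplus> \<ominus> y = x"
  by (simp add: add_assoc closed add_neg add_zero)

lemma neg_add_cancel: "\<lbrakk>x \<in> C; y \<in> C\<rbrakk> \<Longrightarrow> (x \<oplus> \<ominus> y) \<oplus> y = x"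
  by (simp add: add_assoc closed neg_add add_zero)

lemma le_add_iff:
  assumes "x \<in> C" "y \<in> C" "z \<in> C"
  shows "x \<preceq> y \<oplus> z \<longleftrightarrow> x \<oplus> \<ominus> z \<preceq> y"
  using add_mono[of x "y \<oplus> z" "\<ominus> z"] add_mono[of "x \<oplus> \<ominus> z" y z] assms
  by (auto simp: closed add_neg_cancel neg_add_cancel)

lemma diff_le_iff: "\<lbrakk>x \<in> C; y \<in> C; z \<in> C\<rbrakk> \<Longrightarrow> x \<oplus> \<ominus> y \<preceq> z \<longleftrightarrow> x \<preceq> y \<oplus> z"
  using le_add_iff[of x z y] by (simp add: add_commute)

lemma le_diff_iff: "\<lbrakk>x \<in> C; y \<in> C; z \<in> C\<rbrakk> \<Longrightarrow> x \<preceq> y \<oplus> \<ominus> z \<longleftrightarrow> x \<oplus> z \<preceq> y"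
  using le_add_iff[of x y "\<ominus> z"] by (simp add: closed neg_neg)

lemma diff_nonneg_iff: "\<lbrakk>x \<in> C; y \<in> C\<rbrakk> \<Longrightarrow> \<zero> \<preceq> y \<oplus> \<ominus> x \<longleftrightarrow> x \<preceq> y"
  by (simp add: le_diff_iff closed zero_add)

lemma add_nonneg: "\<lbrakk>x \<in> C; y \<in> C; \<zero> \<preceq> x; \<zero> \<preceq> y\<rbrakk> \<Longrightarrow> \<zero> \<preceq> x \<oplus> y"
  using add_mono[of \<zero> x y] le_trans[of \<zero> y "x \<oplus> y"] by (simp add: closed zero_add)

lemma le_add_nonneg:
  assumes "x \<in> C" "y \<in> C" "\<zero> \<preceq> y"
  shows "x \<preceq> x \<oplus> y" "x \<preceq> y \<oplus> x"
  using add_mono[of \<zero> y x] assms by (simp_all add: zero_closed zero_add add_commute[of x y])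

lemma scale_nonneg: "\<lbrakk>x \<in> C; \<zero> \<preceq> x; 0 \<le> a\<rbrakk> \<Longrightarrow> \<zero> \<preceq> rscale R a x"
  using scale_mono[of \<zero> x a] by (simp add: zero_closed scale_zero_right)

lemma add_mono2:
  assumes "x \<in> C" "y \<in> C" "u \<in> C" "v \<in> C" "x \<preceq> y" "u \<preceq> v"
  shows "x \<oplus> u \<preceq> y \<oplus> v"
  using add_mono[of x y u] add_mono[of u v y] le_trans[of "x \<oplus> u" "y \<oplus> u" "y \<oplus> v"] assms
  by (simp add: closed add_commute[of _ y])

section \<open>Absolute values and decompositions of vectors\<close>

lemma lub_unique: "\<lbrakk>is_lub R S z; is_lub R S z'\<rbrakk> \<Longrightarrow> z = z'"
  using le_antisym[of z z'] by (auto simp: is_lub_def)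

lemma rabs_lub:
  assumes "x \<in> C"
  shows "is_lub R {x, \<ominus> x} (rabs R x)"
proof -
  obtain z where z: "is_lub R {x, \<ominus> x} z" using ex_sup assms scale_closed by blast
  show ?thesis unfolding rabs_def by (rule theI[of _ z]) (use z lub_unique in blast)+
qed

lemma rabs_closed: "x \<in> C \<Longrightarrow> rabs R x \<in> C"
  and le_rabs: "x \<in> C \<Longrightarrow> x \<preceq> rabs R x"
  and neg_le_rabs: "x \<in> C \<Longrightarrow> \<ominus> x \<preceq> rabs R x"
  and rabs_le: "\<lbrakk>x \<in> C; e \<in> C; x \<preceq> e; \<ominus> x \<preceq> e\<rbrakk> \<Longrightarrow> rabs R x \<preceq> e"
  using rabs_lub[of x] by (auto simp: is_lub_def)

lemma bound_add_nonneg: "\<lbrakk>x \<in> C; e \<in> C; \<ominus> x \<preceq> e\<rbrakk> \<Longrightarrow> \<zero> \<preceq> e \<oplus> x"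
  using diff_nonneg_iff[of "\<ominus> x" e] by (simp add: closed neg_neg)

text \<open>Adding the two bounds gives that e + e is positive, and scaling by 1/2 keeps the
  cone.\<close>

lemma bound_nonneg:
  assumes "x \<in> C" "e \<in> C" "x \<preceq> e" "\<ominus> x \<preceq> e"
  shows "\<zero> \<preceq> e"
proof -
  have "\<zero> \<preceq> e \<oplus> e"
    using add_mono2[of x e "\<ominus> x" e] assms by (simp add: closed add_neg)
  moreover have "rscale R (1/2) (e \<oplus> e) = e"
    using scale_add_left[of e "1/2" "1/2"] assms by (simp add: scale_add_right scale_one)
  ultimately show ?thesis using scale_nonneg[of "e \<oplus> e" "1/2"] assms by (simp add: closed)
qed

lemma rabs_nonneg: "x \<in> C \<Longrightarrow> \<zero> \<preceq> rabs R x"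
  by (rule bound_nonneg[OF _ rabs_closed le_rabs neg_le_rabs])

text \<open>The choice x = (|x| + x) - |x| needs only the two bounds that define |x|, no identity
  between positive and negative parts.\<close>

lemma pos_diff:
  assumes "x \<in> C"
  obtains a b where "a \<in> C" "b \<in> C" "\<zero> \<preceq> a" "\<zero> \<preceq> b" "x = a \<oplus> \<ominus> b"
proof
  let ?e = "rabs R x"
  show "rabs R x \<oplus> x \<in> C" "rabs R x \<in> C" "\<zero> \<preceq> rabs R x"
    using assms by (auto simp: closed rabs_closed rabs_nonneg)
  show "\<zero> \<preceq> rabs R x \<oplus> x"
    using assms by (simp add: bound_add_nonneg neg_le_rabs rabs_closed)
  show "x = (rabs R x \<oplus> x) \<oplus> \<ominus> (rabs R x)"
    using assms add_neg_cancel[of x "rabs R x"] by (simp add: add_commute[of _ x] rabs_closed)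
qed

text \<open>Take u as the infimum of y and a, and v = y - u. Since y - b lies below both y and a, it
  lies below u, which says that v is at most b.\<close>

lemma riesz_decomposition:
  assumes "y \<in> C" "a \<in> C" "b \<in> C" "\<zero> \<preceq> y" "\<zero> \<preceq> a" "\<zero> \<preceq> b" "y \<preceq> a \<oplus> b"
  obtains u v where "u \<in> C" "v \<in> C" "\<zero> \<preceq> u" "u \<preceq> a" "\<zero> \<preceq> v" "v \<preceq> b" "y = u \<oplus> v"
proof -
  obtain u where u: "is_glb R {y, a} u" using ex_inf assms by blast
  then have uC: "u \<in> C" "u \<preceq> y" "u \<preceq> a" and umax: "\<And>w. \<lbrakk>w \<in> C; w \<preceq> y; w \<preceq> a\<rbrakk> \<Longrightarrow> w \<preceq> u"
    by (auto simp: is_glb_def)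
  have "y \<oplus> \<ominus> b \<preceq> y"
    using assms add_mono[of \<zero> b y] by (simp add: diff_le_iff closed zero_add)
  moreover have "y \<oplus> \<ominus> b \<preceq> a" using assms by (simp add: le_add_iff)
  ultimately have "y \<oplus> \<ominus> b \<preceq> u" using umax assms by (simp add: closed)
  then have v: "y \<oplus> \<ominus> u \<preceq> b"
    using assms uC le_add_iff[of y u b] diff_le_iff[of y u b] by simp
  show thesis
  proof
    show "\<zero> \<preceq> u" using umax assms by (simp add: closed)
    show "\<zero> \<preceq> y \<oplus> \<ominus> u" using uC assms by (simp add: diff_nonneg_iff)
    show "y = u \<oplus> (y \<oplus> \<ominus> u)" 
      using assms uC neg_add_cancel[of y u] by (simp add: add_commute[of u] closed)
  qed (use assms uC v in \<open>auto simp: closed\<close>)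
qed

section \<open>Extending functions from the positive cone to linear functionals\<close>

definition additive_on_cone :: "('a \<Rightarrow> real) \<Rightarrow> bool" where
  "additive_on_cone p \<longleftrightarrow>
     (\<forall>x\<in>C. \<forall>y\<in>C. \<zero> \<preceq> x \<longrightarrow> \<zero> \<preceq> y \<longrightarrow> p (x \<oplus> y) = p x + p y) \<and>
     (\<forall>a\<ge>0. \<forall>x\<in>C. \<zero> \<preceq> x \<longrightarrow> p (rscale R a x) = a * p x)"

lemma lin_add: "\<lbrakk>linear_functional R f; x \<in> C; y \<in> C\<rbrakk> \<Longrightarrow> f (x \<oplus> y) = f x + f y"
  and lin_scale: "\<lbrakk>linear_functional R f; x \<in> C\<rbrakk> \<Longrightarrow> f (rscale R a x) = a * f x"
  by (auto simp: linear_functional_def)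

lemma lin_zero: "linear_functional R f \<Longrightarrow> f \<zero> = 0"
  using lin_scale[of f \<zero> 0] by (simp add: zero_closed scale_zero_left)

lemma lin_diff: "\<lbrakk>linear_functional R f; x \<in> C; y \<in> C\<rbrakk> \<Longrightarrow> f (x \<oplus> \<ominus> y) = f x - f y"
  by (simp add: lin_add lin_scale closed)

lemma lin_mono:
  assumes "linear_functional R f" "\<And>x. \<lbrakk>x \<in> C; \<zero> \<preceq> x\<rbrakk> \<Longrightarrow> 0 \<le> f x"
    "x \<in> C" "y \<in> C" "x \<preceq> y"
  shows "f x \<le> f y"
  using assms(2)[of "y \<oplus> \<ominus> x"] assms by (simp add: lin_diff diff_nonneg_iff closed)

text \<open>This is Kantorovich's extension. The value p(|x| + x) - p(|x|) equals p(a) - p(b) for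
  every decomposition x = a - b into positive vectors (\<open>key\<close>), so linearity can be
  checked with whichever decomposition is convenient.\<close>

lemma additive_extension:
  assumes "additive_on_cone p"
  obtains f where "f \<in> extensional C" "linear_functional R f"
    "\<And>x. \<lbrakk>x \<in> C; \<zero> \<preceq> x\<rbrakk> \<Longrightarrow> f x = p x"
proof
  have padd: "p (x \<oplus> y) = p x + p y" if "x \<in> C" "y \<in> C" "\<zero> \<preceq> x" "\<zero> \<preceq> y" for x y
    using assms that by (auto simp: additive_on_cone_def)
  have pscale: "p (rscale R a x) = a * p x" if "x \<in> C" "\<zero> \<preceq> x" "0 \<le> a" for a x
    using assms that by (auto simp: additive_on_cone_def)
  let ?f = "\<lambda>x\<in>C. p (rabs R x \<oplus> x) - p (rabs R x)"
  have key: "?f x = p a - p b" 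
    if "a \<in> C" "b \<in> C" "\<zero> \<preceq> a" "\<zero> \<preceq> b" "x = a \<oplus> \<ominus> b" for x a b
  proof -
    have xC: "x \<in> C" using that by (simp add: closed)
    have n: "\<zero> \<preceq> rabs R x \<oplus> x"
      using xC by (simp add: bound_add_nonneg neg_le_rabs rabs_closed)
    have "(rabs R x \<oplus> x) \<oplus> b = rabs R x \<oplus> a"
      using that xC neg_add_cancel[of a b] by (simp add: add_assoc rabs_closed)
    then have "p (rabs R x \<oplus> x) + p b = p (rabs R x) + p a"
      using padd[of "rabs R x \<oplus> x" b] padd[of "rabs R x" a] that(1-4) n xC
      by (simp add: rabs_closed rabs_nonneg closed)
    then show ?thesis using xC by simp
  qed
  show "?f \<in> extensional C" by simp
  show "?f x = p x" if "x \<in> C" "\<zero> \<preceq> x" for x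
    using key[of x \<zero> x] that pscale[of \<zero> 0] by (simp add: closed le_refl neg_zero add_zero scale_zero_left)
  show "linear_functional R ?f"
    unfolding linear_functional_def
  proof (intro conjI ballI allI)
    fix x y assume xy: "x \<in> C" "y \<in> C"
    obtain a b where ab: "a \<in> C" "b \<in> C" "\<zero> \<preceq> a" "\<zero> \<preceq> b" "x = a \<oplus> \<ominus> b" using pos_diff xy by metis
    obtain c d where cd: "c \<in> C" "d \<in> C" "\<zero> \<preceq> c" "\<zero> \<preceq> d" "y = c \<oplus> \<ominus> d" using pos_diff xy by metis
    have "x \<oplus> y = (a \<oplus> c) \<oplus> \<ominus> (b \<oplus> d)"
      using ab cd by (simp add: scale_add_right closed ac)
    then show "?f (x \<oplus> y) = ?f x + ?f y"
      using key[of "a \<oplus> c" "b \<oplus> d" "x \<oplus> y"] key[of a b x] key[of c d y] ab cd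
      by (simp add: padd closed add_nonneg)
  next
    fix t x assume x: "x \<in> C"
    obtain a b where ab: "a \<in> C" "b \<in> C" "\<zero> \<preceq> a" "\<zero> \<preceq> b" "x = a \<oplus> \<ominus> b" using pos_diff x by metis
    show "?f (rscale R t x) = t * ?f x"
    proof (cases "0 \<le> t")
      case True
      have "rscale R t x = rscale R t a \<oplus> \<ominus> (rscale R t b)"
        using ab by (simp add: scale_add_right closed scale_scale)
      then have "?f (rscale R t x) = p (rscale R t a) - p (rscale R t b)"
        using True ab by (intro key) (auto simp: closed scale_nonneg)
      also have "\<dots> = t * (p a - p b)"
        using True ab by (simp add: pscale algebra_simps)
      also have "p a - p b = ?f x" using ab by (intro key[symmetric])
      finally show ?thesis .
    next
      case False
      \<comment> \<open>A negative scalar exchanges the two parts, after which both are scaled by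
        the nonnegative number -t.\<close>
      have "rscale R t x = rscale R (- t) b \<oplus> \<ominus> (rscale R (- t) a)"
        using ab by (simp add: scale_add_right closed scale_scale add_commute)
      then have "?f (rscale R t x) = p (rscale R (- t) b) - p (rscale R (- t) a)"
        using False ab by (intro key) (auto simp: closed scale_nonneg)
      also have "\<dots> = t * (p a - p b)"
        using False ab by (simp add: pscale algebra_simps)
      also have "p a - p b = ?f x" using ab by (intro key[symmetric])
      finally show ?thesis .
    qed
  qed
qed

end

section \<open>The order dual\<close>

lemma dual_carrier: "f \<in> rcarrier (order_dual R) \<longleftrightarrow>
    f \<in> extensional (rcarrier R) \<and> linear_functional R f \<and> order_bounded_functional R f"
  and dual_add: "radd (order_dual R) f g = (\<lambda>x\<in>rcarrier R. f x + g x)"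
  and dual_scale: "rscale (order_dual R) a f = (\<lambda>x\<in>rcarrier R. a * f x)"
  and dual_zero: "rzero (order_dual R) = (\<lambda>x\<in>rcarrier R. 0)"
  and dual_le: "rle (order_dual R) f g \<longleftrightarrow>
    (\<forall>x\<in>rcarrier R. rle R (rzero R) x \<longrightarrow> f x \<le> g x)"
  by (simp_all add: order_dual_def)

lemmas dual_ops = dual_add dual_scale dual_zero dual_le

lemma dual_lin: "f \<in> rcarrier (order_dual R) \<Longrightarrow> linear_functional R f"
  by (simp add: dual_carrier)

context riesz_space
begin

text \<open>On an order interval from a to b the vector x - a is positive, so domination bounds the
  oscillation |f x - f a| by g x - g a, hence by g b - g a.\<close>

lemma order_bounded_if_dominated:
  assumes f: "linear_functional R f" and g: "linear_functional R g"
    and fg: "\<And>x. \<lbrakk>x \<in> C; \<zero> \<preceq> x\<rbrakk> \<Longrightarrow> \<bar>f x\<bar> \<le> g x"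
  shows "order_bounded_functional R f"
  unfolding order_bounded_functional_def
proof (intro ballI exI impI)
  fix a b x assume h: "a \<in> C" "b \<in> C" "x \<in> C" "a \<preceq> x \<and> x \<preceq> b"
  have "\<bar>f x - f a\<bar> \<le> g x - g a"
    using fg[of "x \<oplus> \<ominus> a"] h f g by (simp add: diff_nonneg_iff lin_diff closed)
  moreover have "g x \<le> g b"
    using fg h by (intro lin_mono[OF g]) (use order_trans[OF abs_ge_zero] in blast)+
  ultimately show "\<bar>f x\<bar> \<le> \<bar>f a\<bar> + (g b - g a)" by linarith
qed

lemma dualI:
  assumes "f \<in> extensional C" "linear_functional R f" "linear_functional R g"
    "\<And>x. \<lbrakk>x \<in> C; \<zero> \<preceq> x\<rbrakk> \<Longrightarrow> \<bar>f x\<bar> \<le> g x"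
  shows "f \<in> rcarrier (order_dual R)"
  using assms order_bounded_if_dominated by (simp add: dual_carrier)

lemma dual_posI:
  assumes "f \<in> extensional C" "linear_functional R f"
    "\<And>x. \<lbrakk>x \<in> C; \<zero> \<preceq> x\<rbrakk> \<Longrightarrow> 0 \<le> f x"
  shows "f \<in> rcarrier (order_dual R)"
  using assms by (intro dualI[of f f]) auto

lemma dual_eqI:
  assumes "f \<in> rcarrier (order_dual R)" "g \<in> rcarrier (order_dual R)"
    "\<And>x. \<lbrakk>x \<in> C; \<zero> \<preceq> x\<rbrakk> \<Longrightarrow> f x = g x"
  shows "f = g"
proof (rule extensionalityI[of _ C])
  fix x assume "x \<in> C"
  then obtain a b where "a \<in> C" "b \<in> C" "\<zero> \<preceq> a" "\<zero> \<preceq> b" "x = a \<oplus> \<ominus> b"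
    using pos_diff by metis
  then show "f x = g x" using assms by (simp add: lin_diff dual_lin)
qed (use assms in \<open>auto simp: dual_carrier\<close>)

lemma dual_add_closed:
  assumes "f \<in> rcarrier (order_dual R)" "g \<in> rcarrier (order_dual R)"
  shows "radd (order_dual R) f g \<in> rcarrier (order_dual R)"
  unfolding dual_carrier
proof (intro conjI)
  show "linear_functional R (radd (order_dual R) f g)"
    using assms by (auto simp: dual_ops linear_functional_def dual_carrier closed algebra_simps)
  show "order_bounded_functional R (radd (order_dual R) f g)"
    unfolding order_bounded_functional_def
  proof (intro ballI)
    fix a b assume ab: "a \<in> C" "b \<in> C"
    obtain M N where
      "\<forall>x\<in>C. a \<preceq> x \<and> x \<preceq> b \<longrightarrow> \<bar>f x\<bar> \<le> M"
      "\<forall>x\<in>C. a \<preceq> x \<and> x \<preceq> b \<longrightarrow> \<bar>g x\<bar> \<le> N"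
      using assms ab unfolding dual_carrier order_bounded_functional_def by meson
    then show "\<exists>M. \<forall>x\<in>C. a \<preceq> x \<and> x \<preceq> b \<longrightarrow> \<bar>radd (order_dual R) f g x\<bar> \<le> M"
      by (intro exI[of _ "M + N"]) (force simp: dual_ops)
  qed
qed (simp add: dual_ops)

lemma dual_scale_closed:
  assumes "f \<in> rcarrier (order_dual R)"
  shows "rscale (order_dual R) c f \<in> rcarrier (order_dual R)"
  unfolding dual_carrier
proof (intro conjI)
  show "linear_functional R (rscale (order_dual R) c f)"
    using assms by (auto simp: dual_ops linear_functional_def dual_carrier closed algebra_simps)
  show "order_bounded_functional R (rscale (order_dual R) c f)"
    unfolding order_bounded_functional_def
  proof (intro ballI)
    fix a b assume ab: "a \<in> C" "b \<in> C"
    obtain M where "\<forall>x\<in>C. a \<preceq> x \<and> x \<preceq> b \<longrightarrow> \<bar>f x\<bar> \<le> M"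
      using assms ab unfolding dual_carrier order_bounded_functional_def by meson
    then show "\<exists>M. \<forall>x\<in>C. a \<preceq> x \<and> x \<preceq> b \<longrightarrow> \<bar>rscale (order_dual R) c f x\<bar> \<le> M"
      by (intro exI[of _ "\<bar>c\<bar> * M"]) (auto simp: dual_ops abs_mult mult_left_mono)
  qed
qed (simp add: dual_ops)

lemma dual_zero_closed: "rzero (order_dual R) \<in> rcarrier (order_dual R)"
  by (rule dual_posI) (auto simp: dual_ops linear_functional_def closed)

text \<open>The Riesz--Kantorovich formula \<open>f\<^sup>+ x = sup {f y | 0 \<le> y \<le> x}\<close>.\<close>

lemma dual_pos_part:
  assumes f: "f \<in> rcarrier (order_dual R)"
  obtains h where "h \<in> rcarrier (order_dual R)"
    "\<And>x. \<lbrakk>x \<in> C; \<zero> \<preceq> x\<rbrakk> \<Longrightarrow> 0 \<le> h x"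
    "\<And>x. \<lbrakk>x \<in> C; \<zero> \<preceq> x\<rbrakk> \<Longrightarrow> f x \<le> h x"
    "\<And>g x. \<lbrakk>g \<in> rcarrier (order_dual R); \<And>y. \<lbrakk>y \<in> C; \<zero> \<preceq> y\<rbrakk> \<Longrightarrow> 0 \<le> g y;
       \<And>y. \<lbrakk>y \<in> C; \<zero> \<preceq> y\<rbrakk> \<Longrightarrow> f y \<le> g y; x \<in> C; \<zero> \<preceq> x\<rbrakk> \<Longrightarrow> h x \<le> g x"
proof -
  have lf: "linear_functional R f" using f by (rule dual_lin)
  define I where "I x = {y \<in> C. \<zero> \<preceq> y \<and> y \<preceq> x}" for x
  define p where "p x = Sup (f ` I x)" for x
  have bdd: "bdd_above (f ` I x)" if "x \<in> C" for x
  proof -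
    have "\<exists>M. \<forall>y\<in>C. \<zero> \<preceq> y \<and> y \<preceq> x \<longrightarrow> \<bar>f y\<bar> \<le> M"
      using f that zero_closed unfolding dual_carrier order_bounded_functional_def by blast
    then obtain M where "\<forall>y\<in>C. \<zero> \<preceq> y \<and> y \<preceq> x \<longrightarrow> \<bar>f y\<bar> \<le> M" by blast
    then show ?thesis unfolding I_def by (intro bdd_aboveI[of _ M]) force
  qed
  have ne: "f ` I x \<noteq> {}" if "x \<in> C" "\<zero> \<preceq> x" for x
    using that by (auto simp: I_def intro!: exI[of _ \<zero>] le_refl zero_closed)
  have up: "f y \<le> p x" if "x \<in> C" "y \<in> C" "\<zero> \<preceq> y" "y \<preceq> x" for x y
    unfolding p_def using that bdd by (intro cSup_upper) (auto simp: I_def)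
  have least: "p x \<le> c" if "x \<in> C" "\<zero> \<preceq> x" "\<And>y. \<lbrakk>y \<in> C; \<zero> \<preceq> y; y \<preceq> x\<rbrakk> \<Longrightarrow> f y \<le> c" for x c
    unfolding p_def using that ne by (intro cSup_least) (auto simp: I_def)
  \<comment> \<open>One inequality splits each w below x + y by the Riesz decomposition. The other
    takes the suprema over u and over v one after the other.\<close>
  have padd: "p (x \<oplus> y) = p x + p y" if xy: "x \<in> C" "y \<in> C" "\<zero> \<preceq> x" "\<zero> \<preceq> y" for x y
  proof (rule antisym)
    show "p (x \<oplus> y) \<le> p x + p y"
    proof (rule least)
      fix w assume w: "w \<in> C" "\<zero> \<preceq> w" "w \<preceq> x \<oplus> y"
      obtain u v where uv: "u \<in> C" "v \<in> C" "\<zero> \<preceq> u" "u \<preceq> x" "\<zero> \<preceq> v" "v \<preceq> y" "w = u \<oplus> v"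
        using riesz_decomposition[OF w(1) xy(1,2) w(2) xy(3,4) w(3)] by blast
      have "f w = f u + f v" unfolding uv(7) using lf uv(1,2) by (rule lin_add)
      moreover have "f u \<le> p x" "f v \<le> p y" using uv xy by (auto intro: up)
      ultimately show "f w \<le> p x + p y" by linarith
    qed (use xy in \<open>auto simp: closed add_nonneg\<close>)
    have "p x \<le> p (x \<oplus> y) - p y"
    proof (rule least)
      fix u assume u: "u \<in> C" "\<zero> \<preceq> u" "u \<preceq> x"
      have "p y \<le> p (x \<oplus> y) - f u"
      proof (rule least)
        fix v assume v: "v \<in> C" "\<zero> \<preceq> v" "v \<preceq> y"
        have "f (u \<oplus> v) \<le> p (x \<oplus> y)"
          using u v xy by (intro up) (auto simp: closed add_nonneg intro: add_mono2)
        then show "f v \<le> p (x \<oplus> y) - f u" using lf u v by (simp add: lin_add)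
      qed (use xy in auto)
      then show "f u \<le> p (x \<oplus> y) - p y" by simp
    qed (use xy in auto)
    then show "p x + p y \<le> p (x \<oplus> y)" by simp
  qed
  \<comment> \<open>The opposite inequality is this one again, for the scalar 1/a and the vector a
    x.\<close>
  have psc1: "p (rscale R a x) \<le> a * p x" if "0 < a" "x \<in> C" "\<zero> \<preceq> x" for a x
  proof (rule least)
    fix y assume y: "y \<in> C" "\<zero> \<preceq> y" "y \<preceq> rscale R a x"
    have "rscale R (1/a) y \<preceq> rscale R (1/a) (rscale R a x)"
      using that y by (intro scale_mono) (auto simp: closed)
    then have "f (rscale R (1/a) y) \<le> p x"
      using that y by (intro up) (auto simp: closed scale_nonneg scale_scale scale_one)
    then show "f y \<le> a * p x" using that lf y by (simp add: lin_scale field_simps)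
  qed (use that in \<open>auto simp: closed scale_nonneg\<close>)
  have psc: "p (rscale R a x) = a * p x" if "0 \<le> a" "x \<in> C" "\<zero> \<preceq> x" for a x
  proof (cases "a = 0")
    case True
    have "y = \<zero>" if "y \<in> C" "\<zero> \<preceq> y" "y \<preceq> \<zero>" for y
      using that zero_closed by (intro le_antisym)
    then have "I \<zero> = {\<zero>}" by (auto simp: I_def zero_closed le_refl)
    then show ?thesis using True that lf by (simp add: scale_zero_left p_def lin_zero)
  next
    case False
    then have "p x \<le> 1 / a * p (rscale R a x)"
      using psc1[of "1/a" "rscale R a x"] that by (simp add: closed scale_nonneg scale_scale scale_one)
    then show ?thesis using psc1[of a x] False that by (simp add: field_simps)
  qed
  have "additive_on_cone p" unfolding additive_on_cone_def using padd psc by blast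
  then obtain h where h: "h \<in> extensional C" "linear_functional R h"
    "\<And>x. \<lbrakk>x \<in> C; \<zero> \<preceq> x\<rbrakk> \<Longrightarrow> h x = p x" using additive_extension by metis
  have p0: "0 \<le> p x" if "x \<in> C" "\<zero> \<preceq> x" for x
    using up[of x \<zero>] that lf by (simp add: zero_closed le_refl lin_zero)
  show thesis
  proof
    show "h \<in> rcarrier (order_dual R)" using h p0 by (intro dual_posI) auto
    show "0 \<le> h x" if "x \<in> C" "\<zero> \<preceq> x" for x using h p0 that by simp
    show "f x \<le> h x" if "x \<in> C" "\<zero> \<preceq> x" for x using h up that by (simp add: le_refl)
    show "h x \<le> g x" if g: "g \<in> rcarrier (order_dual R)" "\<And>y. \<lbrakk>y \<in> C; \<zero> \<preceq> y\<rbrakk> \<Longrightarrow> 0 \<le> g y"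
      "\<And>y. \<lbrakk>y \<in> C; \<zero> \<preceq> y\<rbrakk> \<Longrightarrow> f y \<le> g y" and x: "x \<in> C" "\<zero> \<preceq> x" for g x
    proof -
      have "p x \<le> g x"
      proof (rule least[OF x])
        fix y assume y: "y \<in> C" "\<zero> \<preceq> y" "y \<preceq> x"
        have "g y \<le> g x" using g x y by (intro lin_mono) (auto simp: dual_lin)
        then show "f y \<le> g x" using g(3)[OF y(1,2)] by simp
      qed
      then show ?thesis using h x by simp
    qed
  qed
qed

text \<open>With h the positive part of f - g, the supremum is g + h and the infimum is f -
  h.\<close>

lemma dual_ex_sup_inf:
  assumes f: "f \<in> rcarrier (order_dual R)" and g: "g \<in> rcarrier (order_dual R)"
  shows "\<exists>z. is_lub (order_dual R) {f, g} z" "\<exists>z. is_glb (order_dual R) {f, g} z"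
proof -
  let ?D = "order_dual R"
  define d where "d = radd ?D f (rscale ?D (- 1) g)"
  have d: "d \<in> rcarrier ?D" unfolding d_def using f g by (intro dual_add_closed dual_scale_closed)
  have dx: "d x = f x - g x" if "x \<in> C" for x using that by (simp add: d_def dual_ops)
  obtain h where h: "h \<in> rcarrier ?D"
    "\<And>x. \<lbrakk>x \<in> C; \<zero> \<preceq> x\<rbrakk> \<Longrightarrow> 0 \<le> h x"
    "\<And>x. \<lbrakk>x \<in> C; \<zero> \<preceq> x\<rbrakk> \<Longrightarrow> d x \<le> h x"
    and hmin: "\<And>g x. \<lbrakk>g \<in> rcarrier ?D; \<And>y. \<lbrakk>y \<in> C; \<zero> \<preceq> y\<rbrakk> \<Longrightarrow> 0 \<le> g y;
       \<And>y. \<lbrakk>y \<in> C; \<zero> \<preceq> y\<rbrakk> \<Longrightarrow> d y \<le> g y; x \<in> C; \<zero> \<preceq> x\<rbrakk> \<Longrightarrow> h x \<le> g x"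
    by (rule dual_pos_part[OF d]) blast
  have "is_lub ?D {f, g} (radd ?D g h)"
    unfolding is_lub_def
  proof (intro conjI ballI impI)
    show "radd ?D g h \<in> rcarrier ?D" using g h(1) by (rule dual_add_closed)
    show "rle ?D s (radd ?D g h)" if "s \<in> {f, g}" for s
      using that h dx by (fastforce simp: dual_ops)
    show "rle ?D (radd ?D g h) w" if w: "w \<in> rcarrier ?D" "\<forall>s\<in>{f, g}. rle ?D s w" for w
    proof -
      have "h x \<le> radd ?D w (rscale ?D (- 1) g) x" if "x \<in> C" "\<zero> \<preceq> x" for x
        using w that g by (intro hmin dual_add_closed dual_scale_closed) (auto simp: dual_ops dx)
      then show ?thesis by (force simp: dual_ops)
    qed
  qed
  then show "\<exists>z. is_lub ?D {f, g} z" by blast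
  have "is_glb ?D {f, g} (radd ?D f (rscale ?D (- 1) h))"
    unfolding is_glb_def
  proof (intro conjI ballI impI)
    show "radd ?D f (rscale ?D (- 1) h) \<in> rcarrier ?D"
      using f h(1) by (intro dual_add_closed dual_scale_closed)
    show "rle ?D (radd ?D f (rscale ?D (- 1) h)) s" if "s \<in> {f, g}" for s
      using that h dx by (fastforce simp: dual_ops)
    show "rle ?D w (radd ?D f (rscale ?D (- 1) h))" if w: "w \<in> rcarrier ?D" "\<forall>s\<in>{f, g}. rle ?D w s" for w
    proof -
      have "h x \<le> radd ?D f (rscale ?D (- 1) w) x" if "x \<in> C" "\<zero> \<preceq> x" for x
        using w that f by (intro hmin dual_add_closed dual_scale_closed) (auto simp: dual_ops dx)
      then show ?thesis by (force simp: dual_ops)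
    qed
  qed
  then show "\<exists>z. is_glb ?D {f, g} z" by blast
qed

lemma riesz_space_dual: "riesz_space (order_dual R)"
proof
  let ?D = "order_dual R"
  fix f g h :: "'a \<Rightarrow> real" and a b :: real
  show "rzero ?D \<in> rcarrier ?D" by (rule dual_zero_closed)
  assume f: "f \<in> rcarrier ?D"
  then have fe: "f \<in> extensional C" by (simp add: dual_carrier)
  show "rscale ?D a f \<in> rcarrier ?D" using f by (rule dual_scale_closed)
  show "radd ?D f (rzero ?D) = f"
    using fe by (auto simp: dual_ops fun_eq_iff extensional_def)
  show "\<exists>y\<in>rcarrier ?D. radd ?D f y = rzero ?D"
    by (rule bexI[OF _ dual_scale_closed[OF f, of "- 1"]]) (auto simp: dual_ops)
  show "rscale ?D (a + b) f = radd ?D (rscale ?D a f) (rscale ?D b f)"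
    by (auto simp: dual_ops fun_eq_iff algebra_simps)
  show "rscale ?D a (rscale ?D b f) = rscale ?D (a * b) f" by (auto simp: dual_ops)
  show "rscale ?D 1 f = f" using fe by (auto simp: dual_ops fun_eq_iff extensional_def)
  show "rle ?D f f" by (simp add: dual_ops)
  assume g: "g \<in> rcarrier ?D"
  show "radd ?D f g \<in> rcarrier ?D" using f g by (rule dual_add_closed)
  show "radd ?D f g = radd ?D g f" by (auto simp: dual_ops)
  show "rscale ?D a (radd ?D f g) = radd ?D (rscale ?D a f) (rscale ?D a g)"
    by (auto simp: dual_ops fun_eq_iff algebra_simps)
  show "\<exists>z. is_lub ?D {f, g} z" "\<exists>z. is_glb ?D {f, g} z"
    using dual_ex_sup_inf[OF f g] by auto
  show "f = g" if "rle ?D f g" "rle ?D g f"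
    using that f g by (intro dual_eqI) (auto simp: dual_ops intro: order.antisym)
  show "rle ?D (rscale ?D a f) (rscale ?D a g)" if "rle ?D f g" "0 \<le> a"
    using that by (auto simp: dual_ops mult_left_mono)
  assume h: "h \<in> rcarrier ?D"
  show "radd ?D (radd ?D f g) h = radd ?D f (radd ?D g h)" by (auto simp: dual_ops)
  show "rle ?D f h" if "rle ?D f g" "rle ?D g h"
    using that by (fastforce simp: dual_ops)
  show "rle ?D (radd ?D f h) (radd ?D g h)" if "rle ?D f g"
    using that by (auto simp: dual_ops)
qed

end

section \<open>The absolute weak topology\<close>

context riesz_space
begin

lemma dual_abs_closed: "f \<in> rcarrier (order_dual R) \<Longrightarrow> rabs (order_dual R) f \<in> rcarrier (order_dual R)"
  by (rule riesz_space.rabs_closed[OF riesz_space_dual])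

lemma dual_abs_ge:
  assumes "f \<in> rcarrier (order_dual R)" "x \<in> C" "\<zero> \<preceq> x"
  shows "\<bar>f x\<bar> \<le> rabs (order_dual R) f x"
  using riesz_space.le_rabs[OF riesz_space_dual assms(1)]
    riesz_space.neg_le_rabs[OF riesz_space_dual assms(1)] assms(2,3)
  by (force simp: dual_ops)

lemma dual_abs_nonneg:
  "\<lbrakk>f \<in> rcarrier (order_dual R); x \<in> C; \<zero> \<preceq> x\<rbrakk> \<Longrightarrow> 0 \<le> rabs (order_dual R) f x"
  using dual_abs_ge order_trans[OF abs_ge_zero] by blast

lemma dual_abs_le:
  assumes "f \<in> rcarrier (order_dual R)" "g \<in> rcarrier (order_dual R)"
    "\<And>y. \<lbrakk>y \<in> C; \<zero> \<preceq> y\<rbrakk> \<Longrightarrow> \<bar>f y\<bar> \<le> g y" "x \<in> C" "\<zero> \<preceq> x"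
  shows "rabs (order_dual R) f x \<le> g x"
proof -
  have "rle (order_dual R) f g" "rle (order_dual R) (rscale (order_dual R) (- 1) f) g"
    using assms(3) by (fastforce simp: dual_ops abs_le_iff)+
  then have "rle (order_dual R) (rabs (order_dual R) f) g"
    by (intro riesz_space.rabs_le[OF riesz_space_dual assms(1,2)])
  then show ?thesis using assms(4,5) by (simp add: dual_le)
qed

lemma dual_abs_eq:
  assumes "f \<in> rcarrier (order_dual R)" "\<And>x. \<lbrakk>x \<in> C; \<zero> \<preceq> x\<rbrakk> \<Longrightarrow> 0 \<le> f x"
  shows "rabs (order_dual R) f = f"
proof (rule dual_eqI)
  fix x assume "x \<in> C" "\<zero> \<preceq> x"
  then show "rabs (order_dual R) f x = f x"
    using dual_abs_le[OF assms(1,1), of x] dual_abs_ge[OF assms(1), of x] assms(2) by force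
qed (use assms dual_abs_closed in auto)

text \<open>Both e + x and e - x are positive, and 2 f x is the difference of the values of f there,
  so the two estimates add up to 2 g e. Allowing any e above x and -x, instead of |x| only, is what
  estimates in several variables require.\<close>

lemma dominated_bound:
  assumes f: "linear_functional R f" and g: "linear_functional R g"
    and fg: "\<And>y. \<lbrakk>y \<in> C; \<zero> \<preceq> y\<rbrakk> \<Longrightarrow> \<bar>f y\<bar> \<le> g y"
    and x: "x \<in> C" "e \<in> C" "x \<preceq> e" "\<ominus> x \<preceq> e"
  shows "\<bar>f x\<bar> \<le> g e"
proof -
  have "\<bar>f e + f x\<bar> \<le> g e + g x" "\<bar>f e - f x\<bar> \<le> g e - g x"
    using fg[of "e \<oplus> x"] fg[of "e \<oplus> \<ominus> x"] f g x
    by (simp_all add: lin_add lin_scale closed bound_add_nonneg diff_nonneg_iff)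
  then show ?thesis by linarith
qed

lemma dual_nonneg:
  "rle (order_dual R) (rzero (order_dual R)) f \<longleftrightarrow> (\<forall>x\<in>C. \<zero> \<preceq> x \<longrightarrow> 0 \<le> f x)"
  by (simp add: dual_ops)

text \<open>This is \<open>dominated_bound\<close> one level up, with g as the bound for f and -f.
  Nearly every later estimate passes through it.\<close>

lemma bidual_bound:
  assumes v: "v \<in> rcarrier (order_bidual R)" "w \<in> rcarrier (order_bidual R)"
    and vw: "\<And>\<phi>. \<lbrakk>\<phi> \<in> rcarrier (order_dual R); \<And>x. \<lbrakk>x \<in> C; \<zero> \<preceq> x\<rbrakk> \<Longrightarrow> 0 \<le> \<phi> x\<rbrakk> \<Longrightarrow> \<bar>v \<phi>\<bar> \<le> w \<phi>"
    and f: "f \<in> rcarrier (order_dual R)" "g \<in> rcarrier (order_dual R)"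
    and fg: "\<And>x. \<lbrakk>x \<in> C; \<zero> \<preceq> x\<rbrakk> \<Longrightarrow> \<bar>f x\<bar> \<le> g x"
  shows "\<bar>v f\<bar> \<le> w g"
proof (rule riesz_space.dominated_bound[OF riesz_space_dual dual_lin dual_lin, OF v _ f])
  show "\<bar>v \<phi>\<bar> \<le> w \<phi>" if "\<phi> \<in> rcarrier (order_dual R)"
    "rle (order_dual R) (rzero (order_dual R)) \<phi>" for \<phi>
    using that vw by (simp add: dual_nonneg)
qed (use fg in \<open>fastforce simp: dual_ops abs_le_iff\<close>)+

lemma bidual_abs_ge:
  assumes "v \<in> rcarrier (order_bidual R)" "\<phi> \<in> rcarrier (order_dual R)"
    "\<And>x. \<lbrakk>x \<in> C; \<zero> \<preceq> x\<rbrakk> \<Longrightarrow> 0 \<le> \<phi> x"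
  shows "\<bar>v \<phi>\<bar> \<le> rabs (order_bidual R) v \<phi>"
  using riesz_space.dual_abs_ge[OF riesz_space_dual assms(1,2)] assms(3) by (simp add: dual_nonneg)

lemma bidual_abs_le:
  assumes "v \<in> rcarrier (order_bidual R)" "w \<in> rcarrier (order_bidual R)"
    "\<And>\<phi>. \<lbrakk>\<phi> \<in> rcarrier (order_dual R); \<And>x. \<lbrakk>x \<in> C; \<zero> \<preceq> x\<rbrakk> \<Longrightarrow> 0 \<le> \<phi> x\<rbrakk> \<Longrightarrow> \<bar>v \<phi>\<bar> \<le> w \<phi>"
    "\<phi> \<in> rcarrier (order_dual R)" "\<And>x. \<lbrakk>x \<in> C; \<zero> \<preceq> x\<rbrakk> \<Longrightarrow> 0 \<le> \<phi> x"
  shows "rabs (order_bidual R) v \<phi> \<le> w \<phi>"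
  using riesz_space.dual_abs_le[OF riesz_space_dual assms(1,2) _ assms(4)] assms(3,5)
  by (simp add: dual_nonneg)

lemma bidual_abs_closed:
  "v \<in> rcarrier (order_bidual R) \<Longrightarrow> rabs (order_bidual R) v \<in> rcarrier (order_bidual R)"
  by (rule riesz_space.dual_abs_closed[OF riesz_space_dual])

text \<open>J(|x|) dominates J(x) on positive functionals, which gives order boundedness.\<close>

lemma canonical_closed:
  assumes "x \<in> C"
  shows "canonical R x \<in> rcarrier (order_bidual R)"
proof (rule riesz_space.dualI[OF riesz_space_dual])
  have *: "linear_functional (order_dual R) (canonical R y)" if "y \<in> C" for y
    using that dual_add_closed dual_scale_closed
    by (auto simp: linear_functional_def canonical_def) (auto simp: dual_ops)
  show "linear_functional (order_dual R) (canonical R x)"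
    "linear_functional (order_dual R) (canonical R (rabs R x))"
    using * assms rabs_closed by auto
  show "\<bar>canonical R x \<phi>\<bar> \<le> canonical R (rabs R x) \<phi>"
    if "\<phi> \<in> rcarrier (order_dual R)" "rle (order_dual R) (rzero (order_dual R)) \<phi>" for \<phi>
    using that assms dominated_bound[of \<phi> \<phi> x "rabs R x"]
    by (simp add: canonical_def dual_nonneg dual_lin rabs_closed le_rabs neg_le_rabs)
qed (simp add: canonical_def)

section \<open>Seminorm distances, convergence and order continuity\<close>

lemma dual_minus:
  assumes "f \<in> rcarrier (order_dual R)" "g \<in> rcarrier (order_dual R)"
  shows "rminus (order_dual R) f g \<in> rcarrier (order_dual R)"
    and "x \<in> C \<Longrightarrow> rminus (order_dual R) f g x = f x - g x"
  unfolding rminus_def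
  by (intro dual_add_closed dual_scale_closed assms) (simp add: dual_ops)

lemmas bidual_minus = riesz_space.dual_minus[OF riesz_space_dual]

text \<open>At a positive functional this is the distance in one of the seminorms that generate
  |\<sigma>|. At other functionals it is no distance, hence the positivity assumptions
  below.\<close>

definition bidual_dist :: "(('a \<Rightarrow> real) \<Rightarrow> real) \<Rightarrow> (('a \<Rightarrow> real) \<Rightarrow> real) \<Rightarrow> ('a \<Rightarrow> real) \<Rightarrow> real" where
  "bidual_dist v w = rabs (order_bidual R) (rminus (order_bidual R) v w)"

lemma bidual_dist_triangle:
  assumes "u \<in> rcarrier (order_bidual R)" "v \<in> rcarrier (order_bidual R)" "w \<in> rcarrier (order_bidual R)"
    and f: "f \<in> rcarrier (order_dual R)" "\<And>x. \<lbrakk>x \<in> C; \<zero> \<preceq> x\<rbrakk> \<Longrightarrow> 0 \<le> f x"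
  shows "bidual_dist u w f \<le> bidual_dist u v f + bidual_dist v w f"
proof -
  let ?g = "radd (order_bidual R) (bidual_dist u v) (bidual_dist v w)"
  have "bidual_dist u w f \<le> ?g f"
    unfolding bidual_dist_def[of u w]
  proof (rule bidual_abs_le[OF _ _ _ f])
    show "?g \<in> rcarrier (order_bidual R)"
      unfolding bidual_dist_def using assms
      by (intro riesz_space.dual_add_closed[OF riesz_space_dual] bidual_abs_closed bidual_minus)
    fix \<phi> assume \<phi>: "\<phi> \<in> rcarrier (order_dual R)" "\<And>x. \<lbrakk>x \<in> C; \<zero> \<preceq> x\<rbrakk> \<Longrightarrow> 0 \<le> \<phi> x"
    show "\<bar>rminus (order_bidual R) u w \<phi>\<bar> \<le> ?g \<phi>"
      using bidual_abs_ge[OF bidual_minus(1)[OF assms(1,2)] \<phi>]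
        bidual_abs_ge[OF bidual_minus(1)[OF assms(2,3)] \<phi>] assms \<phi>(1)
      by (simp add: dual_ops bidual_dist_def bidual_minus(2))
  qed (use assms in \<open>auto intro: bidual_minus\<close>)
  then show ?thesis using f by (simp add: dual_ops)
qed

lemma bidual_dist_self:
  assumes "u \<in> rcarrier (order_bidual R)" "f \<in> rcarrier (order_dual R)" "\<And>x. \<lbrakk>x \<in> C; \<zero> \<preceq> x\<rbrakk> \<Longrightarrow> 0 \<le> f x"
  shows "bidual_dist u u f = 0"
proof -
  let ?z = "rzero (order_bidual R)"
  have "bidual_dist u u f \<le> ?z f"
    unfolding bidual_dist_def using assms
    by (intro bidual_abs_le riesz_space.dual_zero_closed[OF riesz_space_dual] bidual_minus)
      (auto simp: bidual_minus(2) dual_ops)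
  moreover have "\<bar>rminus (order_bidual R) u u f\<bar> \<le> bidual_dist u u f"
    unfolding bidual_dist_def using assms by (intro bidual_abs_ge bidual_minus)
  ultimately show ?thesis using assms by (simp add: dual_ops)
qed

text \<open>The subbase has balls about every centre, whereas convergence to l should be tested only
  with balls about l. The triangle inequality puts a ball about l inside each subbasic ball that
  contains l, and induction over the generation of open sets does the rest.\<close>

lemma limitin_abs_weak:
  "limitin (abs_weak_topology R) h l G \<longleftrightarrow> l \<in> rcarrier (order_bidual R) \<and>
     (\<forall>\<phi>\<in>rcarrier (order_dual R). \<forall>\<epsilon>>0. eventually (\<lambda>i. h i \<in> rcarrier (order_bidual R) \<and>
        bidual_dist (h i) l (rabs (order_dual R) \<phi>) < \<epsilon>) G)"
  (is "?L \<longleftrightarrow> _ \<and> ?P")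
proof -
  let ?X = "rcarrier (order_bidual R)" and ?Y = "rcarrier (order_dual R)" and ?a = "rabs (order_dual R)"
  define b where "b u \<phi> \<epsilon> = {v \<in> ?X. bidual_dist v u (?a \<phi>) < \<epsilon>}" for u \<phi> and \<epsilon> :: real
  define S where "S = {b u \<phi> \<epsilon> | u \<phi> \<epsilon>. u \<in> ?X \<and> \<phi> \<in> ?Y \<and> \<epsilon> > 0}"
  have T: "abs_weak_topology R = topology_generated_by S"
    unfolding abs_weak_topology_def S_def b_def bidual_dist_def by simp
  have centre: "u \<in> b u \<phi> \<epsilon>" if "u \<in> ?X" "\<phi> \<in> ?Y" "\<epsilon> > 0" for u \<phi> \<epsilon>
    using that by (simp add: b_def bidual_dist_self dual_abs_closed dual_abs_nonneg)
  have top: "topspace (abs_weak_topology R) = ?X"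
  proof
    show "topspace (abs_weak_topology R) \<subseteq> ?X"
      unfolding T topology_generated_by_topspace by (auto simp: S_def b_def)
    show "?X \<subseteq> topspace (abs_weak_topology R)"
    proof
      fix u assume u: "u \<in> ?X"
      then have "b u (rzero (order_dual R)) 1 \<in> S"
        unfolding S_def using dual_zero_closed zero_less_one by blast
      then show "u \<in> topspace (abs_weak_topology R)"
        using centre[OF u dual_zero_closed, of 1]
        unfolding T topology_generated_by_topspace by auto
    qed
  qed
  have open_b: "openin (abs_weak_topology R) (b u \<phi> \<epsilon>)" if "u \<in> ?X" "\<phi> \<in> ?Y" "\<epsilon> > 0" for u \<phi> \<epsilon>
    unfolding T openin_topology_generated_by_iff
    by (rule generate_topology_on.Basis) (use that in \<open>auto simp: S_def\<close>)
  show ?thesis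
  proof (intro iffI conjI ballI allI impI)
    assume L: ?L
    then show l: "l \<in> ?X" by (simp add: limitin_def top)
    fix \<phi> and \<epsilon> :: real assume "\<phi> \<in> ?Y" "0 < \<epsilon>"
    then show "eventually (\<lambda>i. h i \<in> ?X \<and> bidual_dist (h i) l (?a \<phi>) < \<epsilon>) G"
      using limitinD[OF L open_b[OF l] centre[OF l]] by (simp add: b_def)
  next
    assume R: "l \<in> ?X \<and> ?P"
    have "eventually (\<lambda>i. h i \<in> U) G" if "generate_topology_on S U" "l \<in> U" for U
      using that
    proof induction
      case (Int U V)
      then show ?case by (auto intro: eventually_conj)
    next
      case (UN K)
      then obtain k where "k \<in> K" "l \<in> k" by blast
      then show ?case using UN.IH[of k] by (auto elim: eventually_mono)
    next
      case (Basis s)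
      then obtain u \<phi> \<epsilon> where s: "s = b u \<phi> \<epsilon>" "u \<in> ?X" "\<phi> \<in> ?Y" "\<epsilon> > 0" by (auto simp: S_def)
      \<comment> \<open>The slack between the radius and the distance of l from the centre u is the
        radius to use about l.\<close>
      then have lt: "0 < \<epsilon> - bidual_dist l u (?a \<phi>)" using Basis by (simp add: b_def)
      have "eventually (\<lambda>i. h i \<in> ?X \<and> bidual_dist (h i) l (?a \<phi>) < \<epsilon> - bidual_dist l u (?a \<phi>)) G"
        using R s(3) lt by blast
      then show ?case
      proof (rule eventually_mono)
        fix i assume i: "h i \<in> ?X \<and> bidual_dist (h i) l (?a \<phi>) < \<epsilon> - bidual_dist l u (?a \<phi>)"
        then show "h i \<in> s"
          using bidual_dist_triangle[of "h i" l u "?a \<phi>"] R s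
          by (simp add: b_def dual_abs_closed dual_abs_nonneg)
      qed
    qed simp
    then show ?L using R unfolding limitin_def top unfolding T openin_topology_generated_by_iff by blast
  qed
qed

text \<open>The sets of all w with |w| at most d, for d in D, are a base of a filter, and this
  filter is order null by construction. Convergence of z along it yields one d that works for all
  such w at once.\<close>

lemma order_cont_small:
  assumes z: "z \<in> order_cont_dual R" and D: "D \<noteq> {}" "D \<subseteq> C"
    "\<And>d e. \<lbrakk>d \<in> D; e \<in> D\<rbrakk> \<Longrightarrow> \<exists>c\<in>D. c \<preceq> d \<and> c \<preceq> e"
    "is_glb R D \<zero>" and "0 < \<epsilon>"
  obtains d where "d \<in> D" "\<And>w. \<lbrakk>w \<in> C; rabs R w \<preceq> d\<rbrakk> \<Longrightarrow> \<bar>z w\<bar> < \<epsilon>"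
proof -
  define S where "S d = {w \<in> C. rabs R w \<preceq> d}" for d
  define G where "G = (INF d\<in>D. principal (S d))"
  have ev: "eventually Q G \<longleftrightarrow> (\<exists>d\<in>D. \<forall>w\<in>S d. Q w)" for Q
    unfolding G_def
  proof (subst eventually_INF_base)
    fix a b assume "a \<in> D" "b \<in> D"
    then obtain c where c: "c \<in> D" "c \<preceq> a" "c \<preceq> b" using D(3) by blast
    then have "S c \<subseteq> S a \<inter> S b"
      using D(2) \<open>a \<in> D\<close> \<open>b \<in> D\<close> unfolding S_def
      by (auto intro: le_trans[OF rabs_closed _ _ _ c(2)] le_trans[OF rabs_closed _ _ _ c(3)])
    then show "\<exists>x\<in>D. principal (S x) \<le> inf (principal (S a)) (principal (S b))"
      using c by auto
  qed (use D(1) in \<open>auto simp: eventually_principal\<close>)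
  have "order_null R G"
    unfolding order_null_def using D by (intro exI[of _ D]) (auto simp: ev S_def)
  then have "(z \<longlongrightarrow> 0) G" using z by (simp add: order_cont_dual_def)
  then have "eventually (\<lambda>w. \<bar>z w\<bar> < \<epsilon>) G" using \<open>0 < \<epsilon>\<close> by (simp add: tendsto_iff)
  then show thesis using that unfolding ev S_def by blast
qed

end

section \<open>Interchanging two functionals\<close>

text \<open>What a net converging to v leaves behind when its index set is forgotten. One positive
  functional at a time suffices, since several of them can be replaced by their sum.\<close>

definition approximable :: "'a riesz \<Rightarrow> (('a \<Rightarrow> real) \<Rightarrow> real) \<Rightarrow> bool" where
  "approximable R v \<longleftrightarrow> v \<in> rcarrier (order_bidual R) \<and>
     (\<forall>\<phi>\<in>rcarrier (order_dual R). \<forall>\<epsilon>>0. (\<forall>x\<in>rcarrier R. rle R (rzero R) x \<longrightarrow> 0 \<le> \<phi> x) \<longrightarrow>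
        (\<exists>t\<in>rcarrier R. riesz_space.bidual_dist R (canonical R t) v \<phi> < \<epsilon>))"

text \<open>P plays the part of the modulus of B; any positive majorant will do.\<close>

definition dominated_bilinear ::
    "'a riesz \<Rightarrow> 'b riesz \<Rightarrow> ('a \<Rightarrow> 'b \<Rightarrow> real) \<Rightarrow> ('a \<Rightarrow> 'b \<Rightarrow> real) \<Rightarrow> bool" where
  "dominated_bilinear R S B P \<longleftrightarrow>
     (\<forall>s\<in>rcarrier S. linear_functional R (\<lambda>t. B t s) \<and> linear_functional R (\<lambda>t. P t s)) \<and>
     (\<forall>t\<in>rcarrier R. linear_functional S (B t) \<and> linear_functional S (P t)) \<and>
     (\<forall>t\<in>rcarrier R. \<forall>s\<in>rcarrier S. rle R (rzero R) t \<longrightarrow> rle S (rzero S) s \<longrightarrow> \<bar>B t s\<bar> \<le> P t s)"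

definition adjoint_form ::
    "'a riesz \<Rightarrow> 'b riesz \<Rightarrow> (('a \<Rightarrow> real) \<Rightarrow> real) \<Rightarrow> ('a \<Rightarrow> 'b \<Rightarrow> real) \<Rightarrow> 'b \<Rightarrow> real" where
  "adjoint_form R S v B = (\<lambda>s\<in>rcarrier S. v (\<lambda>t\<in>rcarrier R. B t s))"

lemma dominated_bilinear_flip:
  "dominated_bilinear R S B P \<Longrightarrow> dominated_bilinear S R (\<lambda>s t. B t s) (\<lambda>s t. P t s)"
  by (auto simp: dominated_bilinear_def)

lemma dominated_bilinear_self: "dominated_bilinear R S B P \<Longrightarrow> dominated_bilinear R S P P"
  unfolding dominated_bilinear_def by (force intro: order_trans[OF abs_ge_zero])

lemma linear_functional_restrict:
  assumes "riesz_space R" "linear_functional R f"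
  shows "linear_functional R (restrict f (rcarrier R))"
  using assms by (auto simp: linear_functional_def riesz_space.closed)

text \<open>For fixed s the section of B is dominated by the section of P at |s|. The adjoint form
  of v is then dominated by that of |v| and P, which gives its order boundedness.\<close>

lemma adjoint_form_dual:
  assumes RS: "riesz_space R" "riesz_space S" and BP: "dominated_bilinear R S B P"
  shows "s \<in> rcarrier S \<Longrightarrow> (\<lambda>t\<in>rcarrier R. B t s) \<in> rcarrier (order_dual R)"
    and "v \<in> rcarrier (order_bidual R) \<Longrightarrow> adjoint_form R S v B \<in> rcarrier (order_dual S)"
    and "\<lbrakk>v \<in> rcarrier (order_bidual R); w \<in> rcarrier (order_bidual R);
       \<And>\<phi>. \<lbrakk>\<phi> \<in> rcarrier (order_dual R); \<And>x. \<lbrakk>x \<in> rcarrier R; rle R (rzero R) x\<rbrakk> \<Longrightarrow> 0 \<le> \<phi> x\<rbrakk> \<Longrightarrow> \<bar>v \<phi>\<bar> \<le> w \<phi>;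
       s \<in> rcarrier S; rle S (rzero S) s\<rbrakk> \<Longrightarrow> \<bar>adjoint_form R S v B s\<bar> \<le> adjoint_form R S w P s"
proof -
  interpret R: riesz_space R by (fact RS)
  interpret S: riesz_space S by (fact RS)
  have sec: "(\<lambda>t\<in>R.C. B' t s) \<in> rcarrier (order_dual R)"
    if "dominated_bilinear R S B' P" "s \<in> S.C" for s B'
  proof (rule R.dualI[where g = "\<lambda>t. P t (rabs S s)"])
    show "\<bar>(\<lambda>t\<in>R.C. B' t s) t\<bar> \<le> P t (rabs S s)"
      if "t \<in> R.C" "rle R (rzero R) t" for t
      using that \<open>dominated_bilinear R S B' P\<close> \<open>s \<in> S.C\<close>
        S.dominated_bound[of "B' t" "P t" s "rabs S s"]
      by (simp add: dominated_bilinear_def S.rabs_closed S.le_rabs S.neg_le_rabs)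
  qed (use that in \<open>auto simp: dominated_bilinear_def S.rabs_closed RS intro!: linear_functional_restrict\<close>)
  note PP = dominated_bilinear_self[OF BP]
  show "(\<lambda>t\<in>R.C. B t s) \<in> rcarrier (order_dual R)" if "s \<in> S.C" for s using sec[OF BP that] .
  show dom: "\<bar>adjoint_form R S v B s\<bar> \<le> adjoint_form R S w P s"
    if "v \<in> rcarrier (order_bidual R)" "w \<in> rcarrier (order_bidual R)"
      "\<And>\<phi>. \<lbrakk>\<phi> \<in> rcarrier (order_dual R); \<And>x. \<lbrakk>x \<in> R.C; rle R (rzero R) x\<rbrakk> \<Longrightarrow> 0 \<le> \<phi> x\<rbrakk> \<Longrightarrow> \<bar>v \<phi>\<bar> \<le> w \<phi>"
      "s \<in> S.C" "rle S (rzero S) s" for v w s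
    using R.bidual_bound[OF that(1-3) sec[OF BP that(4)] sec[OF PP that(4)]] that(4,5) BP
    by (simp add: adjoint_form_def dominated_bilinear_def)
  have lin: "linear_functional S (adjoint_form R S v B')"
    if v: "v \<in> rcarrier (order_bidual R)" and B': "dominated_bilinear R S B' P" for v B'
    unfolding linear_functional_def
  proof (intro conjI ballI allI)
    fix s s' assume s: "s \<in> S.C" "s' \<in> S.C"
    have "(\<lambda>t\<in>R.C. B' t (radd S s s')) = radd (order_dual R) (\<lambda>t\<in>R.C. B' t s) (\<lambda>t\<in>R.C. B' t s')"
      using B' s by (auto simp: dual_ops dominated_bilinear_def S.lin_add)
    then show "adjoint_form R S v B' (radd S s s') = adjoint_form R S v B' s + adjoint_form R S v B' s'"
      using v s sec[OF B'] by (simp add: adjoint_form_def S.closed riesz_space.lin_add[OF R.riesz_space_dual dual_lin])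
  next
    fix a s assume s: "s \<in> S.C"
    have "(\<lambda>t\<in>R.C. B' t (rscale S a s)) = rscale (order_dual R) a (\<lambda>t\<in>R.C. B' t s)"
      using B' s by (auto simp: dual_ops dominated_bilinear_def S.lin_scale)
    then show "adjoint_form R S v B' (rscale S a s) = a * adjoint_form R S v B' s"
      using v s sec[OF B'] by (simp add: adjoint_form_def S.closed riesz_space.lin_scale[OF R.riesz_space_dual dual_lin])
  qed
  show "adjoint_form R S v B \<in> rcarrier (order_dual S)" if v: "v \<in> rcarrier (order_bidual R)" for v
  proof (rule S.dualI)
    let ?w = "rabs (order_bidual R) v"
    have w: "?w \<in> rcarrier (order_bidual R)" using v by (rule R.bidual_abs_closed)
    show "linear_functional S (adjoint_form R S v B)" "linear_functional S (adjoint_form R S ?w P)"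
      using lin v w BP PP by auto
    show "\<bar>adjoint_form R S v B s\<bar> \<le> adjoint_form R S ?w P s" if "s \<in> S.C" "rle S (rzero S) s" for s
      using that v w by (intro dom) (auto intro: R.bidual_abs_ge)
  qed (simp add: adjoint_form_def)
qed

text \<open>The assumption \<open>pr\<close> bounds p by J t + r with r positive and small at a
  prescribed functional. Hence p splits into a part below J t, for which approximation of z works,
  and an excess over J t that contributes little to either side.\<close>

lemma adjoint_swap_positive:
  assumes RS: "riesz_space R" "riesz_space S" and BP: "dominated_bilinear R S B P"
    and p: "p \<in> rcarrier (order_bidual R)"
    and p0: "\<And>\<phi>. \<lbrakk>\<phi> \<in> rcarrier (order_dual R); \<And>x. \<lbrakk>x \<in> rcarrier R; rle R (rzero R) x\<rbrakk> \<Longrightarrow> 0 \<le> \<phi> x\<rbrakk> \<Longrightarrow> 0 \<le> p \<phi>"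
    and pr: "\<And>\<phi> \<epsilon>. \<lbrakk>\<phi> \<in> rcarrier (order_dual R); \<And>x. \<lbrakk>x \<in> rcarrier R; rle R (rzero R) x\<rbrakk> \<Longrightarrow> 0 \<le> \<phi> x; 0 < (\<epsilon>::real)\<rbrakk> \<Longrightarrow>
       \<exists>t\<in>rcarrier R. \<exists>r\<in>rcarrier (order_bidual R). rle R (rzero R) t \<and> r \<phi> < \<epsilon> \<and>
         (\<forall>\<psi>\<in>rcarrier (order_dual R). (\<forall>x\<in>rcarrier R. rle R (rzero R) x \<longrightarrow> 0 \<le> \<psi> x) \<longrightarrow>
           0 \<le> r \<psi> \<and> p \<psi> \<le> \<psi> t + r \<psi>)"
    and z: "z \<in> order_cont_dual (order_dual S)" "approximable S z"
  shows "z (adjoint_form R S p B) = p (adjoint_form S R z (\<lambda>s t. B t s))"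
proof -
  interpret R: riesz_space R by (fact RS)
  interpret S: riesz_space S by (fact RS)
  interpret DR: riesz_space "order_dual R" by (rule R.riesz_space_dual)
  interpret DS: riesz_space "order_dual S" by (rule S.riesz_space_dual)
  interpret DDR: riesz_space "order_bidual R" by (rule DR.riesz_space_dual)
  note PP = dominated_bilinear_self[OF BP]
  note BP' = dominated_bilinear_flip[OF BP] and PP' = dominated_bilinear_flip[OF PP]
  let ?pos = "\<lambda>\<phi>. \<phi> \<in> DR.C \<and> (\<forall>x\<in>R.C. rle R (rzero R) x \<longrightarrow> 0 \<le> \<phi> x)"
  let ?A = "adjoint_form R S" and ?A' = "\<lambda>w B. adjoint_form S R w (\<lambda>s t. B t s)"
  note adj = adjoint_form_dual[OF RS BP] and adjP = adjoint_form_dual[OF RS PP]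
  note adj' = adjoint_form_dual[OF RS(2,1) BP'] and adjP' = adjoint_form_dual[OF RS(2,1) PP']
  have zb: "z \<in> rcarrier (order_bidual S)" using z(2) by (simp add: approximable_def)
  have "\<exists>b. is_lub (order_bidual R) {rminus (order_bidual R) p (canonical R t), rzero (order_bidual R)} b"
    if "t \<in> R.C" for t
    using DDR.ex_sup[OF R.bidual_minus(1)[OF p R.canonical_closed[OF that]] DDR.zero_closed] .
  \<comment> \<open>\<open>b t\<close> is the positive part of p - J t, the excess of p over J
    t.\<close>
  then obtain b where b: "\<And>t. t \<in> R.C \<Longrightarrow>
      is_lub (order_bidual R) {rminus (order_bidual R) p (canonical R t), rzero (order_bidual R)} (b t)"
    by metis
  have bC: "b t \<in> DDR.C" if "t \<in> R.C" for t using b[OF that] by (simp add: is_lub_def)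
  have mv: "rminus (order_bidual R) p (canonical R t) \<phi> = p \<phi> - \<phi> t" if "t \<in> R.C" "\<phi> \<in> DR.C" for t \<phi>
    using R.bidual_minus(2)[OF p R.canonical_closed[OF that(1)] that(2)] that(2) by (simp add: canonical_def)
  have blub: "rle (order_bidual R) (rminus (order_bidual R) p (canonical R t)) (b t)"
    "rle (order_bidual R) (rzero (order_bidual R)) (b t)"
    "\<And>r. \<lbrakk>r \<in> DDR.C; rle (order_bidual R) (rminus (order_bidual R) p (canonical R t)) r;
       rle (order_bidual R) (rzero (order_bidual R)) r\<rbrakk> \<Longrightarrow> rle (order_bidual R) (b t) r"
    if "t \<in> R.C" for t
    using b[OF that] by (simp_all add: is_lub_def)
  have b0: "0 \<le> b t \<phi>" and bp: "p \<phi> - \<phi> t \<le> b t \<phi>" if "t \<in> R.C" "?pos \<phi>" for t \<phi>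
    using blub(1,2)[OF that(1)] that by (auto simp: dual_ops mv)
  \<comment> \<open>Minimality of the positive part is turned into an inequality of values; with
    \<open>pr\<close> it yields \<open>bsmall\<close>, with r = p it bounds \<open>b t\<close> by
    p.\<close>
  have bmin: "b t \<phi> \<le> r \<phi>" if "t \<in> R.C" "?pos \<phi>" "r \<in> DDR.C"
    "\<And>\<psi>. ?pos \<psi> \<Longrightarrow> 0 \<le> r \<psi> \<and> p \<psi> \<le> \<psi> t + r \<psi>" for t r \<phi>
  proof -
    have "rle (order_bidual R) (b t) r"
      using that(4) by (intro blub(3)[OF that(1,3)]) (auto simp: dual_ops mv[OF that(1)] algebra_simps)
    then show ?thesis using that by (simp add: dual_ops)
  qed
  have bmono: "b t' \<phi> \<le> b t \<phi>" if "t \<in> R.C" "t' \<in> R.C" "rle R t t'" "?pos \<phi>" for t t' \<phi>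
  proof (rule bmin)
    fix \<psi> assume \<psi>: "?pos \<psi>"
    have "\<psi> t \<le> \<psi> t'" using \<psi> that by (intro R.lin_mono dual_lin) auto
    then show "0 \<le> b t \<psi> \<and> p \<psi> \<le> \<psi> t' + b t \<psi>"
      using b0[OF that(1) \<psi>] bp[OF that(1) \<psi>] by linarith
  qed (use that bC in auto)
  have bsmall: "\<exists>t\<in>R.C. rle R (rzero R) t \<and> b t \<phi> < \<epsilon>" if pos: "?pos \<phi>" and eps: "0 < \<epsilon>" for \<phi> \<epsilon>
  proof -
    obtain t r where "t \<in> R.C" "r \<in> DDR.C" "rle R (rzero R) t" "r \<phi> < \<epsilon>"
      "\<And>\<psi>. ?pos \<psi> \<Longrightarrow> 0 \<le> r \<psi> \<and> p \<psi> \<le> \<psi> t + r \<psi>"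
      using pr[of \<phi> \<epsilon>] pos eps by blast
    then show ?thesis using bmin[of t \<phi> r] pos by (intro bexI[of _ t]) auto
  qed
  have Ppos: "?pos (\<lambda>t\<in>R.C. P t s)" if "s \<in> S.C" "rle S (rzero S) s" for s
    using that adjP(1) PP by (auto simp: dominated_bilinear_def)
  have Ppos': "(\<lambda>s\<in>S.C. P t s) \<in> DS.C" "\<And>s. \<lbrakk>s \<in> S.C; rle S (rzero S) s\<rbrakk> \<Longrightarrow> 0 \<le> (\<lambda>s\<in>S.C. P t s) s"
    if "t \<in> R.C" "rle R (rzero R) t" for t
    using that adjP'(1) PP by (auto simp: dominated_bilinear_def)
  have adj_mono: "?A v P s \<le> ?A w P s"
    if "v \<in> DDR.C" "w \<in> DDR.C" "\<And>\<phi>. ?pos \<phi> \<Longrightarrow> v \<phi> \<le> w \<phi>" "s \<in> S.C" "rle S (rzero S) s" for v w s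
    using that(3)[OF Ppos[OF that(4,5)]] that(4) by (simp add: adjoint_form_def)
  \<comment> \<open>D collects the functionals s \<mapsto> \<open>b t\<close> (P(., s)) for positive
    t. It is directed downwards because t + u lies above t and u, and its infimum is 0 by
    \<open>bsmall\<close> at each positive s.\<close>
  define K where "K = {t \<in> R.C. rle R (rzero R) t}"
  define D where "D = (\<lambda>t. ?A (b t) P) ` K"
  \<comment> \<open>Four errors of size \<epsilon> occur: the contributions of the excess
    \<open>b t\<close> to the two sides, and the differences of the two sides for \<open>a\<close>
    from their common approximation at s.\<close>
  have est: "\<bar>z (?A p B) - p (?A' z B)\<bar> \<le> 4 * \<epsilon>" if eps: "0 < \<epsilon>" for \<epsilon>
  proof -
    have "D \<noteq> {}" using R.zero_closed R.le_refl by (auto simp: D_def K_def)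
    moreover have "D \<subseteq> DS.C" using bC adjP(2) by (auto simp: D_def K_def)
    moreover have "\<exists>c\<in>D. rle (order_dual S) c d \<and> rle (order_dual S) c e" if "d \<in> D" "e \<in> D" for d e
    proof -
      obtain t u where tu: "t \<in> K" "u \<in> K" "d = ?A (b t) P" "e = ?A (b u) P"
        using \<open>d \<in> D\<close> \<open>e \<in> D\<close> by (auto simp: D_def)
      have C: "t \<in> R.C" "u \<in> R.C" "radd R t u \<in> R.C" using tu by (auto simp: K_def R.closed)
      have "rle R t (radd R t u)" "rle R u (radd R t u)"
        using tu by (auto simp: K_def intro: R.le_add_nonneg)
      then have "\<And>\<phi>. ?pos \<phi> \<Longrightarrow> b (radd R t u) \<phi> \<le> b t \<phi>" "\<And>\<phi>. ?pos \<phi> \<Longrightarrow> b (radd R t u) \<phi> \<le> b u \<phi>"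
        using bmono C by auto
      then have "rle (order_dual S) (?A (b (radd R t u)) P) d \<and> rle (order_dual S) (?A (b (radd R t u)) P) e"
        using C bC by (auto simp: dual_le tu intro!: adj_mono)
      moreover have "radd R t u \<in> K" using tu R.add_nonneg by (auto simp: K_def R.closed)
      ultimately show ?thesis by (auto simp: D_def)
    qed
    moreover have "is_glb (order_dual S) D (rzero (order_dual S))"
      unfolding is_glb_def
    proof (intro conjI ballI impI)
      show "rzero (order_dual S) \<in> DS.C" by (rule DS.zero_closed)
      show "rle (order_dual S) (rzero (order_dual S)) d" if "d \<in> D" for d
        using that Ppos b0 by (auto simp: D_def K_def S.dual_nonneg adjoint_form_def)
      fix w assume w: "w \<in> DS.C" "\<forall>d\<in>D. rle (order_dual S) w d"
      have "w s \<le> 0" if s: "s \<in> S.C" "rle S (rzero S) s" for s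
      proof (rule field_le_epsilon)
        fix e :: real assume "0 < e"
        then obtain t where t: "t \<in> R.C" "rle R (rzero R) t" "b t (\<lambda>t\<in>R.C. P t s) < e"
          using bsmall[OF Ppos[OF s]] by blast
        have "w s \<le> ?A (b t) P s" using w(2) s t by (auto simp: D_def K_def dual_le)
        then show "w s \<le> 0 + e" using t s by (simp add: adjoint_form_def)
      qed
      then show "rle (order_dual S) w (rzero (order_dual S))" by (simp add: dual_ops)
    qed
    ultimately obtain d where d: "d \<in> D" "\<And>w. \<lbrakk>w \<in> DS.C; rle (order_dual S) (rabs (order_dual S) w) d\<rbrakk> \<Longrightarrow> \<bar>z w\<bar> < \<epsilon>"
      using DS.order_cont_small[OF z(1) _ _ _ _ eps] by metis
    then obtain t1 where t1: "t1 \<in> R.C" "rle R (rzero R) t1" "d = ?A (b t1) P" by (auto simp: D_def K_def)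
    \<comment> \<open>The excess on the other side is \<open>b t\<close> at the functional t
      \<mapsto> z(B(t, .)). This is bounded by t \<mapsto> |z|(P(t, .)), a fixed positive
      functional, at which \<open>t2\<close> makes the excess small.\<close>
    let ?az = "rabs (order_bidual S) z"
    have az: "?az \<in> rcarrier (order_bidual S)" using zb by (rule S.bidual_abs_closed)
    have azp: "?pos (?A' ?az P)"
      using adjP'(2)[OF az] DS.dual_abs_nonneg[OF zb Ppos'(1)] Ppos'(2)
      by (auto simp: adjoint_form_def S.dual_nonneg)
    obtain t2 where t2: "t2 \<in> R.C" "rle R (rzero R) t2" "b t2 (?A' ?az P) < \<epsilon>"
      using bsmall[OF azp eps] by blast
    \<comment> \<open>The excess decreases as t grows, so the sum inherits both the smallness
      obtained from \<open>t1\<close> and that from \<open>t2\<close>.\<close>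
    define t where "t = radd R t1 t2"
    have t: "t \<in> R.C" "rle R (rzero R) t" "rle R t1 t" "rle R t2 t"
      using t1 t2 by (auto simp: t_def intro: R.closed R.add_nonneg R.le_add_nonneg)
    \<comment> \<open>\<open>a\<close> is the infimum of p and J t; only 0 \<le> a \<le> J t is
      used.\<close>
    define a where "a = rminus (order_bidual R) p (b t)"
    have a: "a \<in> DDR.C" "\<And>\<phi>. \<phi> \<in> DR.C \<Longrightarrow> a \<phi> = p \<phi> - b t \<phi>"
      unfolding a_def using R.bidual_minus[OF p bC[OF t(1)]] by auto
    have a0: "0 \<le> a \<phi>" "a \<phi> \<le> \<phi> t" if "?pos \<phi>" for \<phi>
    proof -
      have "b t \<phi> \<le> p \<phi>"
      proof (rule bmin[OF t(1) that p])
        fix \<psi> assume \<psi>: "?pos \<psi>"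
        then have "0 \<le> \<psi> t" using t by auto
        then show "0 \<le> p \<psi> \<and> p \<psi> \<le> \<psi> t + p \<psi>" using p0 \<psi> by auto
      qed
      then show "0 \<le> a \<phi>" "a \<phi> \<le> \<phi> t" using a(2) bp[OF t(1) that] that by auto
    qed
    have zBb: "\<bar>z (?A (b t) B)\<bar> < \<epsilon>"
    proof (rule d(2))
      show "?A (b t) B \<in> DS.C" using adj(2) bC t by blast
      then have "rabs (order_dual S) (?A (b t) B) s \<le> ?A (b t1) P s" if "s \<in> S.C" "rle S (rzero S) s" for s
      proof (rule S.dual_abs_le[OF _ adjP(2)[OF bC[OF t1(1)]] _ that])
        fix s assume s: "s \<in> S.C" "rle S (rzero S) s"
        have "\<bar>?A (b t) B s\<bar> \<le> ?A (b t) P s"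
        proof (rule adj(3)[OF bC bC _ s, OF t(1) t(1)])
          fix \<phi> assume "\<phi> \<in> DR.C" "\<And>x. \<lbrakk>x \<in> R.C; rle R (rzero R) x\<rbrakk> \<Longrightarrow> 0 \<le> \<phi> x"
          then show "\<bar>b t \<phi>\<bar> \<le> b t \<phi>" using b0[OF t(1)] by auto
        qed
        also have "\<dots> \<le> ?A (b t1) P s"
          using bmono[OF t1(1) t(1,3)] s bC t t1 by (intro adj_mono) auto
        finally show "\<bar>?A (b t) B s\<bar> \<le> ?A (b t1) P s" .
      qed
      then show "rle (order_dual S) (rabs (order_dual S) (?A (b t) B)) d"
        by (auto simp: dual_le t1(3))
    qed
    have A'z: "?A' z B \<in> DR.C" using adj'(2)[OF zb] .
    have bz: "\<bar>b t (?A' z B)\<bar> < \<epsilon>"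
    proof -
      have "\<bar>b t (?A' z B)\<bar> \<le> b t (?A' ?az P)"
      proof (rule R.bidual_bound[OF bC bC _ A'z])
        show "?A' ?az P \<in> DR.C" using azp by blast
        fix x assume x: "x \<in> R.C" "rle R (rzero R) x"
        show "\<bar>?A' z B x\<bar> \<le> ?A' ?az P x"
          using adj'(3)[OF zb az _ x] S.bidual_abs_ge[OF zb] by blast
      qed (use t b0 in auto)
      also have "\<dots> \<le> b t2 (?A' ?az P)" using bmono[OF t2(1) t(1,4) azp] .
      finally show ?thesis using t2 by simp
    qed
    \<comment> \<open>A single s must serve \<open>e1\<close> and \<open>e2\<close>, so the two
      positive functionals at which |J s - z| should be small are added.\<close>
    define f2 where "f2 = radd (order_dual S) (?A a P) (\<lambda>s\<in>S.C. P t s)"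
    have AaP: "?A a P \<in> DS.C" "\<And>s. \<lbrakk>s \<in> S.C; rle S (rzero S) s\<rbrakk> \<Longrightarrow> 0 \<le> ?A a P s"
      using adjP(2)[OF a(1)] a0 Ppos by (auto simp: adjoint_form_def)
    have f2: "f2 \<in> DS.C" "\<forall>s\<in>S.C. rle S (rzero S) s \<longrightarrow> 0 \<le> f2 s"
      unfolding f2_def using AaP Ppos'[OF t(1,2)] by (auto simp: DS.add_closed) (simp add: dual_ops)
    obtain s where s: "s \<in> S.C" "S.bidual_dist (canonical S s) z f2 < \<epsilon>"
      using z(2) f2 eps unfolding approximable_def by blast
    define dj where "dj = rminus (order_bidual S) (canonical S s) z"
    have dj: "dj \<in> rcarrier (order_bidual S)" "\<And>\<phi>. \<phi> \<in> DS.C \<Longrightarrow> dj \<phi> = \<phi> s - z \<phi>"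
      unfolding dj_def using S.bidual_minus[OF S.canonical_closed[OF s(1)] zb] by (auto simp: canonical_def)
    let ?adj = "rabs (order_bidual S) dj"
    have adjC: "?adj \<in> rcarrier (order_bidual S)" using dj(1) by (rule S.bidual_abs_closed)
    have adjf2: "?adj f2 < \<epsilon>" using s(2) by (simp add: S.bidual_dist_def dj_def)
    have adjnn: "0 \<le> ?adj \<phi>" if "\<phi> \<in> DS.C" "\<And>s. \<lbrakk>s \<in> S.C; rle S (rzero S) s\<rbrakk> \<Longrightarrow> 0 \<le> \<phi> s" for \<phi>
      using DS.dual_abs_nonneg[OF dj(1) that(1)] that(2) by (auto simp: S.dual_nonneg)
    have f2split: "?adj f2 = ?adj (?A a P) + ?adj (\<lambda>s\<in>S.C. P t s)"
      unfolding f2_def using AaP(1) Ppos'(1)[OF t(1,2)] by (intro DS.lin_add dual_lin adjC)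
    have e1: "\<bar>?A a B s - z (?A a B)\<bar> < \<epsilon>"
    proof -
      have "\<bar>dj (?A a B)\<bar> \<le> ?adj (?A a P)"
      proof (rule S.bidual_bound[OF dj(1) adjC _ adj(2)[OF a(1)] AaP(1)])
        fix s assume s: "s \<in> S.C" "rle S (rzero S) s"
        show "\<bar>?A a B s\<bar> \<le> ?A a P s" using a0(1) by (intro adj(3)[OF a(1) a(1) _ s]) auto
      qed (rule S.bidual_abs_ge[OF dj(1)])
      also have "\<dots> < \<epsilon>" using adjf2 f2split adjnn[OF Ppos'[OF t(1,2)]] by linarith
      finally show ?thesis using dj(2)[OF adj(2)[OF a(1)]] by simp
    qed
    \<comment> \<open>Here the truncation pays off: as \<open>a\<close> is below J t, its value at
      the functional x \<mapsto> |J s - z|(P(x, .)) is at most the value of that functional at the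
      single point t. For p itself there is no such point.\<close>
    have e2: "\<bar>?A a B s - a (?A' z B)\<bar> < \<epsilon>"
    proof -
      have "?A' dj B = rminus (order_dual R) (\<lambda>t\<in>R.C. B t s) (?A' z B)"
        using s(1) dj(2) adj'(1) by (auto simp: rminus_def dual_ops adjoint_form_def)
      then have "a (?A' dj B) = ?A a B s - a (?A' z B)"
        unfolding rminus_def using s(1) adj(1)[OF s(1)] A'z a(1)
        by (simp add: DR.lin_diff dual_lin adjoint_form_def)
      moreover have "\<bar>a (?A' dj B)\<bar> \<le> a (?A' ?adj P)"
      proof (rule R.bidual_bound[OF a(1) a(1) _ adj'(2)[OF dj(1)] adjP'(2)[OF adjC]])
        fix x assume x: "x \<in> R.C" "rle R (rzero R) x"
        show "\<bar>?A' dj B x\<bar> \<le> ?A' ?adj P x"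
          using adj'(3)[OF dj(1) adjC _ x] S.bidual_abs_ge[OF dj(1)] by blast
      qed (use a0(1) in auto)
      moreover have "a (?A' ?adj P) \<le> ?A' ?adj P t"
        using adjP'(2)[OF adjC] Ppos' adjnn by (intro a0(2)) (auto simp: adjoint_form_def)
      moreover have "?A' ?adj P t = ?adj (\<lambda>s\<in>S.C. P t s)" using t by (simp add: adjoint_form_def)
      ultimately show ?thesis using adjf2 f2split adjnn[OF AaP] by linarith
    qed
    have "?A a B = rminus (order_dual S) (?A p B) (?A (b t) B)"
      using a(2) adj(1) by (auto simp: rminus_def dual_ops adjoint_form_def)
    then have "z (?A a B) = z (?A p B) - z (?A (b t) B)"
      unfolding rminus_def using adj(2) p bC t zb by (simp add: DS.lin_diff dual_lin)
    moreover have "a (?A' z B) = p (?A' z B) - b t (?A' z B)" using a(2)[OF A'z] .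
    ultimately show ?thesis using zBb bz e1 e2 by linarith
  qed
  have "\<bar>z (?A p B) - p (?A' z B)\<bar> \<le> 0"
  proof (rule field_le_epsilon)
    fix e :: real assume "0 < e"
    then show "\<bar>z (?A p B) - p (?A' z B)\<bar> \<le> 0 + e" using est[of "e / 4"] by simp
  qed
  then show ?thesis by simp
qed

text \<open>\<open>y\<close> is the difference of the positive functionals \<open>\<bar>y\<bar> + y\<close> and \<open>\<bar>y\<bar>\<close>, which are both at most
  \<open>2 \<bar>y\<bar> \<le> 2 J \<bar>t\<bar> + 2 \<bar>J t - y\<bar>\<close>.\<close>

lemma adjoint_swap:
  assumes RS: "riesz_space R" "riesz_space S" and BP: "dominated_bilinear R S B P"
    and y: "approximable R y" and z: "z \<in> order_cont_dual (order_dual S)" "approximable S z"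
  shows "z (adjoint_form R S y B) = y (adjoint_form S R z (\<lambda>s t. B t s))"
proof -
  interpret R: riesz_space R by (fact RS)
  interpret S: riesz_space S by (fact RS)
  interpret DR: riesz_space "order_dual R" by (rule R.riesz_space_dual)
  interpret DS: riesz_space "order_dual S" by (rule S.riesz_space_dual)
  interpret DDR: riesz_space "order_bidual R" by (rule DR.riesz_space_dual)
  have yb: "y \<in> DDR.C" and zb: "z \<in> rcarrier (order_bidual S)"
    using y z by (auto simp: approximable_def)
  define q where "q = rabs (order_bidual R) y"
  define p where "p = radd (order_bidual R) q y"
  have qb: "q \<in> DDR.C" unfolding q_def using yb by (rule DDR.rabs_closed)
  have pb: "p \<in> DDR.C" unfolding p_def using qb yb by (rule DDR.add_closed)
  have val: "p \<phi> = q \<phi> + y \<phi>" if "\<phi> \<in> DR.C" for \<phi> using that by (simp add: p_def dual_ops)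
  let ?pos = "\<lambda>\<phi>. \<phi> \<in> DR.C \<and> (\<forall>x\<in>R.C. rle R (rzero R) x \<longrightarrow> 0 \<le> \<phi> x)"
  have yq: "\<bar>y \<phi>\<bar> \<le> q \<phi>" if "?pos \<phi>" for \<phi>
    unfolding q_def using that yb by (intro R.bidual_abs_ge) auto
  have approx: "\<exists>t\<in>R.C. \<exists>r\<in>DDR.C. rle R (rzero R) t \<and> r \<phi> < \<epsilon> \<and>
         (\<forall>\<psi>\<in>DR.C. (\<forall>x\<in>R.C. rle R (rzero R) x \<longrightarrow> 0 \<le> \<psi> x) \<longrightarrow> 0 \<le> r \<psi> \<and> v \<psi> \<le> \<psi> t + r \<psi>)"
    if \<phi>: "?pos \<phi>" and \<epsilon>: "0 < \<epsilon>" and v: "\<And>\<psi>. ?pos \<psi> \<Longrightarrow> v \<psi> \<le> 2 * q \<psi>" for v \<phi> \<epsilon>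
  proof -
    \<comment> \<open>Half of \<epsilon> is asked for because r is twice the distance |J t -
      y|.\<close>
    obtain t where t: "t \<in> R.C" "R.bidual_dist (canonical R t) y \<phi> < \<epsilon> / 2"
      using y \<phi> \<epsilon> unfolding approximable_def by (meson half_gt_zero)
    let ?d = "rminus (order_bidual R) (canonical R t) y"
    define r where "r = rscale (order_bidual R) 2 (rabs (order_bidual R) ?d)"
    have d: "?d \<in> DDR.C" "\<And>\<psi>. \<psi> \<in> DR.C \<Longrightarrow> ?d \<psi> = \<psi> t - y \<psi>"
      using R.bidual_minus[OF R.canonical_closed[OF t(1)] yb] by (auto simp: canonical_def)
    have rC: "r \<in> DDR.C" unfolding r_def using d(1) by (intro DDR.scale_closed DDR.rabs_closed)
    have rv: "r \<psi> = 2 * rabs (order_bidual R) ?d \<psi>" if "\<psi> \<in> DR.C" for \<psi>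
      using that by (simp add: r_def dual_ops)
    define u where "u = rscale R 2 (rabs R t)"
    have u: "u \<in> R.C" "rle R (rzero R) u"
      unfolding u_def using t(1) by (auto intro: R.closed R.rabs_closed R.scale_nonneg R.rabs_nonneg)
    have "0 \<le> r \<psi> \<and> v \<psi> \<le> \<psi> u + r \<psi>" if \<psi>: "?pos \<psi>" for \<psi>
    proof
      have d0: "\<bar>?d \<psi>'\<bar> \<le> rabs (order_bidual R) ?d \<psi>'" if "?pos \<psi>'" for \<psi>'
        using that d(1) by (intro R.bidual_abs_ge) auto
      show "0 \<le> r \<psi>" using d0[OF \<psi>] rv \<psi> by auto
      let ?g = "radd (order_bidual R) (canonical R (rabs R t)) (rabs (order_bidual R) ?d)"
      have "q \<psi> \<le> ?g \<psi>"
        unfolding q_def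
      proof (rule R.bidual_abs_le[OF yb])
        show "?g \<in> DDR.C" using t(1) d(1)
          by (intro DDR.add_closed DDR.rabs_closed R.canonical_closed R.rabs_closed)
        fix \<psi>' assume "\<psi>' \<in> DR.C" "\<And>x. \<lbrakk>x \<in> R.C; rle R (rzero R) x\<rbrakk> \<Longrightarrow> 0 \<le> \<psi>' x"
        then have \<psi>': "?pos \<psi>'" by blast
        have "\<bar>\<psi>' t\<bar> \<le> \<psi>' (rabs R t)"

        proof (rule R.dominated_bound[of \<psi>' \<psi>'])
          show "linear_functional R \<psi>'" "linear_functional R \<psi>'" using \<psi>' dual_lin by blast+
          show "\<bar>\<psi>' x\<bar> \<le> \<psi>' x" if "x \<in> R.C" "rle R (rzero R) x" for x using \<psi>' that by simp
        qed (use t(1) in \<open>auto intro: R.rabs_closed R.le_rabs R.neg_le_rabs\<close>)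
        then show "\<bar>y \<psi>'\<bar> \<le> ?g \<psi>'"
          using d0[OF \<psi>'] d(2) \<psi>' by (auto simp: dual_ops canonical_def)
      qed (use \<psi> in auto)
      then have "q \<psi> \<le> \<psi> (rabs R t) + rabs (order_bidual R) ?d \<psi>"
        using \<psi> by (simp add: dual_ops canonical_def)
      moreover have "\<psi> u = 2 * \<psi> (rabs R t)"
        unfolding u_def using \<psi> t(1) by (intro R.lin_scale dual_lin R.rabs_closed) auto
      ultimately show "v \<psi> \<le> \<psi> u + r \<psi>" using v[OF \<psi>] rv \<psi> by auto
    qed
    moreover have "r \<phi> < \<epsilon>" using t(2) \<phi> rv by (simp add: R.bidual_dist_def)
    ultimately show ?thesis using u rC by blast
  qed
  note adj = adjoint_form_dual(2)[OF RS BP] and adj1 = adjoint_form_dual(1)[OF RS BP]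
  have swap: "z (adjoint_form R S v B) = v (adjoint_form S R z (\<lambda>s t. B t s))"
    if "v \<in> DDR.C" "\<And>\<psi>. ?pos \<psi> \<Longrightarrow> 0 \<le> v \<psi> \<and> v \<psi> \<le> 2 * q \<psi>" for v
    using that approx by (intro adjoint_swap_positive[OF RS BP _ _ _ z]) auto
  have "z (adjoint_form R S q B) = q (adjoint_form S R z (\<lambda>s t. B t s))"
  proof (rule swap[OF qb])
    fix \<psi> assume "?pos \<psi>"
    then show "0 \<le> q \<psi> \<and> q \<psi> \<le> 2 * q \<psi>" using yq[of \<psi>] by auto
  qed
  moreover have "z (adjoint_form R S p B) = p (adjoint_form S R z (\<lambda>s t. B t s))"
  proof (rule swap[OF pb])
    fix \<psi> assume "?pos \<psi>"
    then show "0 \<le> p \<psi> \<and> p \<psi> \<le> 2 * q \<psi>" using yq[of \<psi>] val[of \<psi>] by auto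
  qed
  \<comment> \<open>Both sides are additive in the functional on R, so the identity for y follows
    from those for p = q + y and q.\<close>
  moreover have "adjoint_form R S p B = radd (order_dual S) (adjoint_form R S q B) (adjoint_form R S y B)"
    using adj1 by (auto simp: adjoint_form_def dual_ops val)
  then have "z (adjoint_form R S p B) = z (adjoint_form R S q B) + z (adjoint_form R S y B)"
    using adj qb yb zb by (simp add: DS.lin_add dual_lin)
  moreover have "adjoint_form S R z (\<lambda>s t. B t s) \<in> DR.C"
    using adjoint_form_dual(2)[OF RS(2,1) dominated_bilinear_flip[OF BP] zb] .
  ultimately show ?thesis using val by simp
qed

section \<open>Multilinear forms\<close>

lemma multilinear_real:
  "multilinear K E real_riesz B \<longleftrightarrow>
     (\<forall>x\<in>prod_carrier K E. \<forall>i\<in>K. linear_functional (E i) (\<lambda>t. B (x(i := t))))"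
  by (simp add: multilinear_def real_riesz_def linear_functional_def)

text \<open>A form is paired with one positive majorant, because such pairs, unlike moduli, are
  handed on directly by each application of a functional.\<close>

definition dominated_form ::
    "nat set \<Rightarrow> (nat \<Rightarrow> 'a riesz) \<Rightarrow> ((nat \<Rightarrow> 'a) \<Rightarrow> real) \<Rightarrow> ((nat \<Rightarrow> 'a) \<Rightarrow> real) \<Rightarrow> bool" where
  "dominated_form K E B P \<longleftrightarrow> multilinear K E real_riesz B \<and> multilinear K E real_riesz P \<and>
     (\<forall>x\<in>prod_carrier K E. (\<forall>i\<in>K. rle (E i) (rzero (E i)) (x i)) \<longrightarrow> \<bar>B x\<bar> \<le> P x)"

lemma dominated_form_self: "dominated_form K E B P \<Longrightarrow> dominated_form K E P P"
  unfolding dominated_form_def by (force intro: order_trans[OF abs_ge_zero])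

lemma linear_functional_cong:
  assumes "riesz_space R" "\<And>x. x \<in> rcarrier R \<Longrightarrow> f x = g x" "linear_functional R g"
  shows "linear_functional R f"
  using assms(2,3) riesz_space.closed(2,3)[OF assms(1)] by (simp add: linear_functional_def)

lemma multilinear_real_cong:
  assumes E: "\<And>i. i \<in> K \<Longrightarrow> riesz_space (E i)"
    and BB': "\<And>x. x \<in> prod_carrier K E \<Longrightarrow> B x = B' x" and B': "multilinear K E real_riesz B'"
  shows "multilinear K E real_riesz B"
  unfolding multilinear_real
proof (intro ballI)
  fix x i assume x: "x \<in> prod_carrier K E" "i \<in> K"
  show "linear_functional (E i) (\<lambda>t. B (x(i := t)))"
  proof (rule linear_functional_cong[OF E[OF x(2)]])
    show "B (x(i := t)) = B' (x(i := t))" if "t \<in> rcarrier (E i)" for t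
      using that x by (intro BB') (auto simp: PiE_iff extensional_def)
    show "linear_functional (E i) (\<lambda>t. B' (x(i := t)))"
      using B' x by (simp add: multilinear_real)
  qed
qed

lemma dominated_form_cong:
  assumes "\<And>i. i \<in> K \<Longrightarrow> riesz_space (E i)"
    and "\<And>x. x \<in> prod_carrier K E \<Longrightarrow> B x = B' x" "dominated_form K E B' P"
  shows "dominated_form K E B P"
  using assms multilinear_real_cong[OF assms(1,2)] by (simp add: dominated_form_def)

text \<open>B = P - (P - B), and both terms are positive.\<close>

lemma regular_if_dominated_form:
  assumes "dominated_form K E B P"
  shows "regular_multilinear K E real_riesz B"
  unfolding regular_multilinear_def positive_multilinear_def
proof (intro conjI exI)
  have B: "multilinear K E real_riesz B" and P: "multilinear K E real_riesz P"
    using assms by (auto simp: dominated_form_def)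
  show "multilinear K E real_riesz B" "multilinear K E real_riesz P" by fact+
  show "multilinear K E real_riesz (\<lambda>x. P x - B x)"
    using B P by (auto simp: multilinear_real linear_functional_def algebra_simps)
  show "\<forall>x\<in>prod_carrier K E. (\<forall>i\<in>K. rle (E i) (rzero (E i)) (x i)) \<longrightarrow>
      rle real_riesz (rzero real_riesz) (P x)"
    "\<forall>x\<in>prod_carrier K E. (\<forall>i\<in>K. rle (E i) (rzero (E i)) (x i)) \<longrightarrow>
      rle real_riesz (rzero real_riesz) (P x - B x)"
    using assms by (fastforce simp: dominated_form_def real_riesz_def)+
  show "\<forall>x\<in>prod_carrier K E. B x = rminus real_riesz (P x) (P x - B x)"
    by (simp add: rminus_def real_riesz_def)
qed

text \<open>The coordinates are replaced by those of e one at a time. Domination is known only on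
  positive tuples, so coordinates not yet treated are kept positive in the induction; in the new
  coordinate \<open>dominated_bound\<close> then removes positivity.\<close>

lemma dominated_form_bound:
  assumes fin: "finite K" and E: "\<And>i. i \<in> K \<Longrightarrow> riesz_space (E i)"
    and BP: "dominated_form K E B P"
    and x: "x \<in> prod_carrier K E" and e: "e \<in> prod_carrier K E"
    and xe: "\<And>i. i \<in> K \<Longrightarrow> rle (E i) (x i) (e i) \<and> rle (E i) (rscale (E i) (- 1) (x i)) (e i)"
  shows "\<bar>B x\<bar> \<le> P e"
proof -
  have "\<bar>B x\<bar> \<le> P (\<lambda>i. if i \<in> S then e i else x i)"
    if "finite S" "S \<subseteq> K" "x \<in> prod_carrier K E"
      "\<And>i. i \<in> K - S \<Longrightarrow> rle (E i) (rzero (E i)) (x i)"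
      "\<And>i. i \<in> S \<Longrightarrow> rle (E i) (x i) (e i) \<and> rle (E i) (rscale (E i) (- 1) (x i)) (e i)" for S x
    using that
  proof (induction S arbitrary: x)
    case empty
    then show ?case using BP by (simp add: dominated_form_def)
  next
    case (insert j S)
    then have j: "j \<in> K" by simp
    interpret Ej: riesz_space "E j" using E j by blast
    let ?o = "\<lambda>i. if i \<in> S then e i else x i"
    have oC: "?o \<in> prod_carrier K E"
      using insert.prems(1,2) e by (auto simp: PiE_iff extensional_def)
    have "\<bar>B (x(j := x j))\<bar> \<le> P (?o(j := e j))"
    proof (rule Ej.dominated_bound[of "\<lambda>t. B (x(j := t))" "\<lambda>t. P (?o(j := t))"])
      show "linear_functional (E j) (\<lambda>t. B (x(j := t)))" "linear_functional (E j) (\<lambda>t. P (?o(j := t)))"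
        using BP j insert.prems(2) oC unfolding dominated_form_def multilinear_real by blast+
      fix t assume t: "t \<in> rcarrier (E j)" "rle (E j) (rzero (E j)) t"
      have "\<bar>B (x(j := t))\<bar> \<le> P (\<lambda>i. if i \<in> S then e i else (x(j := t)) i)"
      proof (rule insert.IH)
        show "x(j := t) \<in> prod_carrier K E"
          using t j insert.prems(2) by (auto simp: PiE_iff extensional_def)
        show "rle (E i) (rzero (E i)) ((x(j := t)) i)" if "i \<in> K - S" for i
          using that t insert.prems(3)[of i] by auto
        show "rle (E i) ((x(j := t)) i) (e i) \<and> rle (E i) (rscale (E i) (- 1) ((x(j := t)) i)) (e i)"
          if "i \<in> S" for i
          using that insert.hyps(2) insert.prems(4)[of i] by auto
      qed (use insert.prems in auto)
      also have "(\<lambda>i. if i \<in> S then e i else (x(j := t)) i) = ?o(j := t)"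
        using insert.hyps(2) by auto
      finally show "\<bar>B (x(j := t))\<bar> \<le> P (?o(j := t))" .
    qed (use insert.prems j e in \<open>auto simp: PiE_iff\<close>)
    moreover have "?o(j := e j) = (\<lambda>i. if i \<in> insert j S then e i else x i)" by auto
    ultimately show ?case by simp
  qed
  from this[of K x] have "\<bar>B x\<bar> \<le> P (\<lambda>i. if i \<in> K then e i else x i)" using fin x xe by blast
  moreover have "(\<lambda>i. if i \<in> K then e i else x i) = e"
    using x e by (auto simp: PiE_iff extensional_def)
  ultimately show ?thesis by simp
qed

lemma (in riesz_space) neg_le_self: "\<lbrakk>x \<in> C; \<zero> \<preceq> x\<rbrakk> \<Longrightarrow> \<ominus> x \<preceq> x"
  using scale_mono[of \<zero> x 2] le_add_iff[of "\<ominus> x" x \<zero>] add_nonneg[of x x] diff_nonneg_iff[of "\<ominus> x" x]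
  by (simp add: closed neg_neg)

definition abs_tuple :: "nat set \<Rightarrow> (nat \<Rightarrow> 'a riesz) \<Rightarrow> (nat \<Rightarrow> 'a) \<Rightarrow> nat \<Rightarrow> 'a" where
  "abs_tuple K E x = (\<lambda>i\<in>K. rabs (E i) (x i))"

lemma abs_tuple_bound:
  assumes E: "\<And>i. i \<in> K \<Longrightarrow> riesz_space (E i)" and x: "x \<in> prod_carrier K E"
  shows "abs_tuple K E x \<in> prod_carrier K E"
    "i \<in> K \<Longrightarrow> rle (E i) (x i) (abs_tuple K E x i) \<and>
       rle (E i) (rscale (E i) (- 1) (x i)) (abs_tuple K E x i)"
    "i \<in> K \<Longrightarrow> rle (E i) (rzero (E i)) (abs_tuple K E x i)"
  using x E by (auto simp: abs_tuple_def PiE_iff intro: riesz_space.rabs_closed riesz_space.le_rabs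
      riesz_space.neg_le_rabs riesz_space.rabs_nonneg)

lemma dominated_form_abs:
  assumes "finite K" "\<And>i. i \<in> K \<Longrightarrow> riesz_space (E i)" "dominated_form K E B P" "x \<in> prod_carrier K E"
  shows "\<bar>B x\<bar> \<le> P (abs_tuple K E x)"
  using assms abs_tuple_bound[of K E x] by (intro dominated_form_bound) auto

lemma upd_prod_carrier:
  "\<lbrakk>x \<in> prod_carrier K E; t \<in> rcarrier (E j)\<rbrakk> \<Longrightarrow> x(j := t) \<in> prod_carrier (insert j K) E"
  by (auto simp: PiE_iff extensional_def)

lemma dominated_section:
  assumes fin: "finite K" and E: "\<And>i. i \<in> insert j K \<Longrightarrow> riesz_space (E i)"
    and BP: "dominated_form (insert j K) E B P" and x: "x \<in> prod_carrier K E" and j: "j \<notin> K"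
  shows "(\<lambda>t\<in>rcarrier (E j). B (x(j := t))) \<in> rcarrier (order_dual (E j))"
    and "\<lbrakk>t \<in> rcarrier (E j); rle (E j) (rzero (E j)) t\<rbrakk> \<Longrightarrow>
      \<bar>B (x(j := t))\<bar> \<le> P ((abs_tuple K E x)(j := t))"
proof -
  interpret Ej: riesz_space "E j" using E by blast
  note e = abs_tuple_bound[OF E x, OF insertI2]
  have lin: "linear_functional (E j) (\<lambda>t. B' (y(j := t)))"
    if "y \<in> prod_carrier K E" "multilinear (insert j K) E real_riesz B'" for B' y
  proof -
    \<comment> \<open>The tuple y has no coordinate j. A zero is inserted to obtain a point of the
      larger product and is overwritten at once.\<close>
    have "linear_functional (E j) (\<lambda>t. B' ((y(j := rzero (E j)))(j := t)))"
      using that(2) upd_prod_carrier[OF that(1) Ej.zero_closed] unfolding multilinear_real by blast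
    then show ?thesis by simp
  qed
  show bd: "\<bar>B (x(j := t))\<bar> \<le> P ((abs_tuple K E x)(j := t))"
    if "t \<in> rcarrier (E j)" "rle (E j) (rzero (E j)) t" for t
  proof (rule dominated_form_bound[OF _ E BP])
    fix i assume "i \<in> insert j K"
    then show "rle (E i) ((x(j := t)) i) (((abs_tuple K E x)(j := t)) i) \<and>
        rle (E i) (rscale (E i) (- 1) ((x(j := t)) i)) (((abs_tuple K E x)(j := t)) i)"
      using e(2)[of i] that j by (cases "i = j") (auto simp: Ej.le_refl Ej.neg_le_self)
  qed (use that e(1) x fin in \<open>auto intro!: upd_prod_carrier\<close>)
  show "(\<lambda>t\<in>rcarrier (E j). B (x(j := t))) \<in> rcarrier (order_dual (E j))"
  proof (rule Ej.dualI[where g = "\<lambda>t. P ((abs_tuple K E x)(j := t))"])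
    show "linear_functional (E j) (\<lambda>t. P ((abs_tuple K E x)(j := t)))"
      using lin[OF e(1)] BP by (simp add: dominated_form_def)
    show "linear_functional (E j) (\<lambda>t\<in>rcarrier (E j). B (x(j := t)))"
      using lin[OF x] BP linear_functional_restrict[OF Ej.riesz_space_axioms] by (simp add: dominated_form_def)
  qed (use bd in auto)
qed

text \<open>Fixing all variables except i and j brings the form within reach of the results on two
  functionals. The majorant has to be taken at the absolute values of the fixed coordinates, since
  these may have any sign.\<close>

lemma dominated_bilinear_section:
  assumes fin: "finite K" and E: "\<And>k. k \<in> insert i (insert j K) \<Longrightarrow> riesz_space (E k)"
    and BP: "dominated_form (insert i (insert j K)) E B P" and x: "x \<in> prod_carrier K E"
    and ij: "i \<noteq> j" "i \<notin> K" "j \<notin> K"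
  shows "dominated_bilinear (E j) (E i) (\<lambda>t s. B (x(j := t, i := s)))
     (\<lambda>t s. P ((abs_tuple K E x)(j := t, i := s)))"
proof -
  let ?M = "insert i (insert j K)" and ?e = "abs_tuple K E x"
  interpret Ei: riesz_space "E i" using E by blast
  interpret Ej: riesz_space "E j" using E by blast
  have EK: "riesz_space (E k)" if "k \<in> K" for k using E that by blast
  note e = abs_tuple_bound[OF EK x]
  have upd: "y(j := t, i := s) \<in> prod_carrier ?M E"
    if "y \<in> prod_carrier K E" "t \<in> Ej.C" "s \<in> Ei.C" for y t s
    using that by (intro upd_prod_carrier)
  have lin1: "linear_functional (E j) (\<lambda>t. B' (y(j := t, i := s)))"
    if "y \<in> prod_carrier K E" "multilinear ?M E real_riesz B'" "s \<in> Ei.C" for B' y s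
  proof -
    have "linear_functional (E j) (\<lambda>t. B' ((y(j := rzero (E j), i := s))(j := t)))"
      using that(2) upd[OF that(1) Ej.zero_closed that(3)] unfolding multilinear_real by blast
    then show ?thesis using ij(1) by (simp add: fun_upd_twist)
  qed
  have lin2: "linear_functional (E i) (\<lambda>s. B' (y(j := t, i := s)))"
    if "y \<in> prod_carrier K E" "multilinear ?M E real_riesz B'" "t \<in> Ej.C" for B' y t
  proof -
    have "linear_functional (E i) (\<lambda>s. B' ((y(j := t, i := rzero (E i)))(i := s)))"
      using that(2) upd[OF that(1,3) Ei.zero_closed] unfolding multilinear_real by blast
    then show ?thesis by simp
  qed
  have bd: "\<bar>B (x(j := t, i := s))\<bar> \<le> P (?e(j := t, i := s))"
    if ts: "t \<in> Ej.C" "s \<in> Ei.C" "rle (E j) (rzero (E j)) t" "rle (E i) (rzero (E i)) s" for t s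
  proof (rule dominated_form_bound[OF _ E BP])
    fix k assume "k \<in> ?M"
    then show "rle (E k) ((x(j := t, i := s)) k) ((?e(j := t, i := s)) k) \<and>
        rle (E k) (rscale (E k) (- 1) ((x(j := t, i := s)) k)) ((?e(j := t, i := s)) k)"
      using e(2)[of k] ts by (auto simp: Ei.le_refl Ei.neg_le_self Ej.le_refl Ej.neg_le_self)
  qed (use fin upd[OF x ts(1,2)] upd[OF e(1) ts(1,2)] in auto)
  have "multilinear ?M E real_riesz B" "multilinear ?M E real_riesz P"
    using BP by (auto simp: dominated_form_def)
  note lins = lin1[OF x this(1)] lin1[OF e(1) this(2)] lin2[OF x this(1)] lin2[OF e(1) this(2)]
  show ?thesis
    unfolding dominated_bilinear_def by (intro conjI ballI impI lins bd)
qed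

text \<open>One step of the Arens construction, for arbitrary functions B and without restriction to
  a product; \<open>arens_comp_iter_apply\<close> restores the restrictions once for all
  steps.\<close>

definition papply ::
    "(nat \<Rightarrow> 'a riesz) \<Rightarrow> nat \<Rightarrow> (('a \<Rightarrow> real) \<Rightarrow> real) \<Rightarrow> ((nat \<Rightarrow> 'a) \<Rightarrow> real) \<Rightarrow> (nat \<Rightarrow> 'a) \<Rightarrow> real" where
  "papply E j v B x = v (\<lambda>t\<in>rcarrier (E j). B (x(j := t)))"

lemma papply_cong:
  "(\<And>t. t \<in> rcarrier (E j) \<Longrightarrow> B (x(j := t)) = B' (x(j := t))) \<Longrightarrow> papply E j v B x = papply E j v B' x"
  unfolding papply_def by (rule arg_cong[of _ _ v]) auto

definition bidual_dominated :: "'a riesz \<Rightarrow> (('a \<Rightarrow> real) \<Rightarrow> real) \<Rightarrow> (('a \<Rightarrow> real) \<Rightarrow> real) \<Rightarrow> bool" where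
  "bidual_dominated R v w \<longleftrightarrow> v \<in> rcarrier (order_bidual R) \<and> w \<in> rcarrier (order_bidual R) \<and>
     (\<forall>\<phi>\<in>rcarrier (order_dual R). (\<forall>x\<in>rcarrier R. rle R (rzero R) x \<longrightarrow> 0 \<le> \<phi> x) \<longrightarrow> \<bar>v \<phi>\<bar> \<le> w \<phi>)"

lemma bidual_dominated_self: "bidual_dominated R v w \<Longrightarrow> bidual_dominated R w w"
  unfolding bidual_dominated_def by (force intro: order_trans[OF abs_ge_zero])

lemma bidual_dominated_abs:
  "\<lbrakk>riesz_space R; v \<in> rcarrier (order_bidual R)\<rbrakk> \<Longrightarrow> bidual_dominated R v (rabs (order_bidual R) v)"
  unfolding bidual_dominated_def
  by (auto intro: riesz_space.bidual_abs_closed riesz_space.bidual_abs_ge)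

text \<open>Linearity in a remaining variable i is a statement about two variables: with the others
  fixed, the result is an adjoint form, which lies in the order dual of \<open>E i\<close>.\<close>

lemma multilinear_papply:
  assumes fin: "finite K" and E: "\<And>i. i \<in> insert j K \<Longrightarrow> riesz_space (E i)" and j: "j \<notin> K"
    and BP: "dominated_form (insert j K) E B P" and v: "v \<in> rcarrier (order_bidual (E j))"
  shows "multilinear K E real_riesz (papply E j v B)"
  unfolding multilinear_real
proof (intro ballI)
  fix x i assume x: "x \<in> prod_carrier K E" "i \<in> K"
  \<comment> \<open>Erasing coordinate i gives a tuple over the other indices, so that i and j are
    the two free variables.\<close>
  let ?y = "x(i := undefined)"
  have ij: "i \<noteq> j" using x j by blast
  have ins: "insert i (insert j (K - {i})) = insert j K" using x by blast
  have y: "?y \<in> prod_carrier (K - {i}) E" using x by (auto simp: PiE_iff extensional_def)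
  have "dominated_bilinear (E j) (E i) (\<lambda>t s. B (?y(j := t, i := s)))
     (\<lambda>t s. P ((abs_tuple (K - {i}) E ?y)(j := t, i := s)))"
    by (rule dominated_bilinear_section[OF _ _ _ y ij]) (use fin E BP j ins in auto)
  then have adj: "adjoint_form (E j) (E i) v (\<lambda>t s. B (?y(j := t, i := s))) \<in> rcarrier (order_dual (E i))"
    using E x v by (intro adjoint_form_dual) auto
  show "linear_functional (E i) (\<lambda>s. papply E j v B (x(i := s)))"
  proof (rule linear_functional_cong[OF E _ dual_lin[OF adj]])
    show "papply E j v B (x(i := s)) = adjoint_form (E j) (E i) v (\<lambda>t s. B (?y(j := t, i := s))) s"
      if "s \<in> rcarrier (E i)" for s
      using that ij by (simp add: papply_def adjoint_form_def fun_upd_twist)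
  qed (use x in auto)
qed

lemma dominated_form_papply:
  assumes fin: "finite K" and E: "\<And>i. i \<in> insert j K \<Longrightarrow> riesz_space (E i)" and j: "j \<notin> K"
    and BP: "dominated_form (insert j K) E B P" and vw: "bidual_dominated (E j) v w"
  shows "dominated_form K E (papply E j v B) (papply E j w P)"
  unfolding dominated_form_def
proof (intro conjI ballI impI)
  have v: "v \<in> rcarrier (order_bidual (E j))" "w \<in> rcarrier (order_bidual (E j))"
    using vw by (auto simp: bidual_dominated_def)
  note PP = dominated_form_self[OF BP]
  show "multilinear K E real_riesz (papply E j v B)" "multilinear K E real_riesz (papply E j w P)"
    using multilinear_papply[OF fin E j BP v(1)] multilinear_papply[OF fin E j PP v(2)] by auto
  fix x assume x: "x \<in> prod_carrier K E" "\<forall>i\<in>K. rle (E i) (rzero (E i)) (x i)"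
  interpret Ej: riesz_space "E j" using E by blast
  show "\<bar>papply E j v B x\<bar> \<le> papply E j w P x"
    unfolding papply_def
  proof (rule Ej.bidual_bound[OF v])
    show "(\<lambda>t\<in>Ej.C. B (x(j := t))) \<in> rcarrier (order_dual (E j))"
      "(\<lambda>t\<in>Ej.C. P (x(j := t))) \<in> rcarrier (order_dual (E j))"
      using dominated_section(1)[OF fin E BP x(1) j] dominated_section(1)[OF fin E PP x(1) j] by auto
    fix t assume t: "t \<in> Ej.C" "rle (E j) (rzero (E j)) t"
    have "\<forall>i\<in>insert j K. rle (E i) (rzero (E i)) ((x(j := t)) i)" using x(2) t by auto
    then show "\<bar>(\<lambda>t\<in>Ej.C. B (x(j := t))) t\<bar> \<le> (\<lambda>t\<in>Ej.C. P (x(j := t))) t"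
      using BP t upd_prod_carrier[OF x(1) t(1)] unfolding dominated_form_def by auto
  qed (use vw in \<open>auto simp: bidual_dominated_def\<close>)
qed

text \<open>The last index of the list acts first and the head acts last, as in an iterated limit
  whose outermost index is the head.\<close>

definition iter_apply ::
    "(nat \<Rightarrow> 'a riesz) \<Rightarrow> (nat \<Rightarrow> ('a \<Rightarrow> real) \<Rightarrow> real) \<Rightarrow> nat list \<Rightarrow>
     ((nat \<Rightarrow> 'a) \<Rightarrow> real) \<Rightarrow> (nat \<Rightarrow> 'a) \<Rightarrow> real" where
  "iter_apply E u js B = foldr (\<lambda>j. papply E j (u j)) js B"

lemma iter_apply_simps [simp]:
  "iter_apply E u [] B = B"
  "iter_apply E u (j # js) B = papply E j (u j) (iter_apply E u js B)"
  by (simp_all add: iter_apply_def)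

lemma iter_apply_cong: "(\<And>j. j \<in> set js \<Longrightarrow> u j = v j) \<Longrightarrow> iter_apply E u js B = iter_apply E v js B"
  by (induction js) auto

lemma iter_apply_form_cong:
  "\<lbrakk>\<And>y. y \<in> prod_carrier (K \<union> set js) E \<Longrightarrow> B y = B' y; x \<in> prod_carrier K E\<rbrakk> \<Longrightarrow>
     iter_apply E u js B x = iter_apply E u js B' x"
proof (induction js arbitrary: K x)
  case (Cons j js)
  have "iter_apply E u js B (x(j := t)) = iter_apply E u js B' (x(j := t))" if "t \<in> rcarrier (E j)" for t
    using Cons.prems that by (intro Cons.IH[of "insert j K"] upd_prod_carrier) auto
  then show ?case unfolding iter_apply_simps by (rule papply_cong)
qed simp

lemma dominated_form_iter_apply:
  assumes "finite K" "\<And>i. i \<in> K \<union> set js \<Longrightarrow> riesz_space (E i)" "distinct js" "set js \<inter> K = {}"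
    "dominated_form (K \<union> set js) E B P" "\<And>j. j \<in> set js \<Longrightarrow> bidual_dominated (E j) (u j) (w j)"
  shows "dominated_form K E (iter_apply E u js B) (iter_apply E w js P)"
  using assms
proof (induction js arbitrary: K)
  case (Cons j js)
  have "dominated_form (insert j K) E (iter_apply E u js B) (iter_apply E w js P)"
    using Cons.prems by (intro Cons.IH) auto
  then show ?case using Cons.prems by (auto intro!: dominated_form_papply)
qed simp

text \<open>The functional \<open>u j\<close> is linear only on the order dual, so domination is
  needed to keep all intermediate sections there. The combination B + c B' covers sums and multiples
  in one induction.\<close>

lemma iter_apply_combine:
  assumes "finite K" "\<And>i. i \<in> K \<union> set js \<Longrightarrow> riesz_space (E i)" "distinct js" "set js \<inter> K = {}"
    "dominated_form (K \<union> set js) E B P" "dominated_form (K \<union> set js) E B' P'"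
    "\<And>j. j \<in> set js \<Longrightarrow> u j \<in> rcarrier (order_bidual (E j))"
    "\<And>x. x \<in> prod_carrier (K \<union> set js) E \<Longrightarrow> B'' x = B x + c * B' x"
    "x \<in> prod_carrier K E"
  shows "iter_apply E u js B'' x = iter_apply E u js B x + c * iter_apply E u js B' x"
  using assms
proof (induction js arbitrary: K x)
  case (Cons j js)
  interpret Ej: riesz_space "E j" using Cons.prems(2) by auto
  interpret D: riesz_space "order_dual (E j)" by (rule Ej.riesz_space_dual)
  let ?w = "\<lambda>j. rabs (order_bidual (E j)) (u j)"
  have step: "iter_apply E u js B'' (x(j := t)) =
      iter_apply E u js B (x(j := t)) + c * iter_apply E u js B' (x(j := t))" if "t \<in> Ej.C" for t
    using Cons.prems that by (intro Cons.IH[of "insert j K"] upd_prod_carrier) auto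
  have "dominated_form (insert j K) E (iter_apply E u js B) (iter_apply E ?w js P)"
    "dominated_form (insert j K) E (iter_apply E u js B') (iter_apply E ?w js P')"
    using Cons.prems by (auto intro!: dominated_form_iter_apply bidual_dominated_abs)
  then have sec: "(\<lambda>t\<in>Ej.C. iter_apply E u js B (x(j := t))) \<in> D.C"
    "(\<lambda>t\<in>Ej.C. iter_apply E u js B' (x(j := t))) \<in> D.C"
    using Cons.prems by (auto intro!: dominated_section)
  have "(\<lambda>t\<in>Ej.C. iter_apply E u js B'' (x(j := t))) =
     radd (order_dual (E j)) (\<lambda>t\<in>Ej.C. iter_apply E u js B (x(j := t)))
       (rscale (order_dual (E j)) c (\<lambda>t\<in>Ej.C. iter_apply E u js B' (x(j := t))))"
    using step by (auto simp: dual_ops)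
  then show ?case
    using sec Cons.prems(7)[of j] by (simp add: papply_def D.lin_add D.lin_scale D.closed dual_lin)
qed simp

text \<open>Once js has acted, the form has a dominated bilinear section in the two variables
  concerned, and \<open>adjoint_swap\<close> applies to it.\<close>

lemma iter_apply_swap:
  assumes fin: "finite K" and E: "\<And>i. i \<in> insert i' (insert j K) \<union> set js \<Longrightarrow> riesz_space (E i)"
    and dist: "distinct (i' # j # js)" "set (i' # j # js) \<inter> K = {}"
    and BP: "dominated_form (insert i' (insert j K) \<union> set js) E B P"
    and u: "\<And>k. k \<in> set (i' # j # js) \<Longrightarrow> approximable (E k) (u k) \<and> u k \<in> order_cont_dual (order_dual (E k))"
    and x: "x \<in> prod_carrier K E"
  shows "iter_apply E u (i' # j # js) B x = iter_apply E u (j # i' # js) B x"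
proof -
  let ?w = "\<lambda>j. rabs (order_bidual (E j)) (u j)"
  let ?C = "iter_apply E u js B"
  have uC: "u k \<in> rcarrier (order_bidual (E k))" if "k \<in> set (i' # j # js)" for k
    using u[OF that] by (simp add: approximable_def)
  have "dominated_form (insert i' (insert j K)) E ?C (iter_apply E ?w js P)"
    using fin E dist BP uC by (intro dominated_form_iter_apply bidual_dominated_abs) auto
  then have "dominated_bilinear (E j) (E i') (\<lambda>t s. ?C (x(j := t, i' := s)))
     (\<lambda>t s. iter_apply E ?w js P ((abs_tuple K E x)(j := t, i' := s)))"
    using fin E x dist by (intro dominated_bilinear_section) auto
  then have "u i' (adjoint_form (E j) (E i') (u j) (\<lambda>t s. ?C (x(j := t, i' := s)))) =
     u j (adjoint_form (E i') (E j) (u i') (\<lambda>s t. ?C (x(j := t, i' := s))))"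
    by (rule adjoint_swap[rotated 2]) (use u E in auto)
  moreover have "i' \<noteq> j" using dist by auto
  ultimately show ?thesis by (simp add: papply_def adjoint_form_def fun_upd_twist)
qed

text \<open>The innermost functional moves outwards by adjacent swaps. Below the head i the tuple
  has gained coordinate i, so K varies in the induction.\<close>

lemma iter_apply_snoc:
  assumes "finite K" "\<And>i. i \<in> K \<union> set (j # js) \<Longrightarrow> riesz_space (E i)"
    "distinct (j # js)" "set (j # js) \<inter> K = {}" "dominated_form (K \<union> set (j # js)) E B P"
    "\<And>k. k \<in> set (j # js) \<Longrightarrow> approximable (E k) (u k) \<and> u k \<in> order_cont_dual (order_dual (E k))"
    "x \<in> prod_carrier K E"
  shows "iter_apply E u (js @ [j]) B x = iter_apply E u (j # js) B x"
  using assms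
proof (induction js arbitrary: K x)
  case (Cons i js)
  have ins: "insert i K \<union> set (j # js) = K \<union> set (j # i # js)" by auto
  have "iter_apply E u ((i # js) @ [j]) B x = iter_apply E u (i # j # js) B x"
    unfolding append_Cons iter_apply_simps
  proof (rule papply_cong)
    fix t assume "t \<in> rcarrier (E i)"
    then have "iter_apply E u (js @ [j]) B (x(i := t)) = iter_apply E u (j # js) B (x(i := t))"
      using Cons.prems unfolding ins[symmetric] by (intro Cons.IH[of "insert i K"] upd_prod_carrier) auto
    then show "iter_apply E u (js @ [j]) B (x(i := t)) = papply E j (u j) (iter_apply E u js B) (x(i := t))"
      by simp
  qed
  also have "\<dots> = iter_apply E u (j # i # js) B x"
  proof (rule iter_apply_swap)
    have "insert i (insert j K) \<union> set js = K \<union> set (j # i # js)" by auto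
    then show "dominated_form (insert i (insert j K) \<union> set js) E B P" using Cons.prems(5) by metis
  qed (use Cons.prems in auto)
  finally show ?case .
qed simp

lemma iter_apply_rev:
  assumes "finite K" "\<And>i. i \<in> K \<union> set js \<Longrightarrow> riesz_space (E i)"
    "distinct js" "set js \<inter> K = {}" "dominated_form (K \<union> set js) E B P"
    "\<And>k. k \<in> set js \<Longrightarrow> approximable (E k) (u k) \<and> u k \<in> order_cont_dual (order_dual (E k))"
    "x \<in> prod_carrier K E"
  shows "iter_apply E u (rev js) B x = iter_apply E u js B x"
  using assms
proof (induction js arbitrary: K x)
  case (Cons j js)
  have "iter_apply E u (rev (j # js)) B x = iter_apply E u (j # rev js) B x"
    unfolding rev.simps using Cons.prems by (intro iter_apply_snoc[of K]) auto
  also have "\<dots> = iter_apply E u (j # js) B x"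
    unfolding iter_apply_simps
    using Cons.prems by (intro papply_cong Cons.IH[of "insert j K"] upd_prod_carrier) auto
  finally show ?case .
qed simp

section \<open>Limits of iterated functionals\<close>

lemma multilinear_compose:
  assumes A: "multilinear M E F A" and y: "linear_functional F y'"
  shows "multilinear M E real_riesz (\<lambda>x. y' (A x))"
  unfolding multilinear_real
proof (intro ballI)
  fix x i assume x: "x \<in> prod_carrier M E" "i \<in> M"
  have "A (x(i := t)) \<in> rcarrier F" if "t \<in> rcarrier (E i)" for t
    using A upd_prod_carrier[OF x(1) that] x(2) unfolding multilinear_def by (simp add: insert_absorb)
  then show "linear_functional (E i) (\<lambda>t. y' (A (x(i := t))))"
    using A x y unfolding linear_functional_def multilinear_def by auto
qed

text \<open>P and Q are fixed once, so that the majorants depend on y' only through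
  composition.\<close>

locale regular_operator = F: riesz_space F
  for F :: "'b riesz" +
  fixes M :: "nat set" and E :: "nat \<Rightarrow> 'a riesz" and A P Q :: "(nat \<Rightarrow> 'a) \<Rightarrow> 'b"
  assumes fin: "finite M" and riesz: "i \<in> M \<Longrightarrow> riesz_space (E i)"
    and A: "multilinear M E F A"
    and P: "positive_multilinear M E F P" and Q: "positive_multilinear M E F Q"
    and APQ: "x \<in> prod_carrier M E \<Longrightarrow> A x = rminus F (P x) (Q x)"
begin

abbreviation "dualF \<equiv> rcarrier (order_dual F)"

definition pos_form :: "('b \<Rightarrow> real) \<Rightarrow> (nat \<Rightarrow> 'a) \<Rightarrow> real" where
  "pos_form y' x = y' (P x) + y' (Q x)"

text \<open>To be used with z' = y' for positive y', and with z' = |y'| in general.\<close>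

lemma form_dominated:
  assumes y: "y' \<in> dualF" and z: "z' \<in> dualF"
    and yz: "\<And>s. \<lbrakk>s \<in> F.C; rle F (rzero F) s\<rbrakk> \<Longrightarrow> \<bar>y' s\<bar> \<le> z' s"
  shows "dominated_form M E (\<lambda>x. y' (A x)) (pos_form z')"
    and "dominated_form M E (pos_form y') (pos_form z')"
proof -
  have lin: "linear_functional F y'" "linear_functional F z'" using y z by (auto intro: dual_lin)
  have PQm: "multilinear M E F P" "multilinear M E F Q"
    using P Q by (auto simp: positive_multilinear_def)
  have pf: "multilinear M E real_riesz (pos_form f)" if "linear_functional F f" for f
    using multilinear_compose[OF PQm(1) that] multilinear_compose[OF PQm(2) that]
    unfolding multilinear_real linear_functional_def pos_form_def by (simp add: algebra_simps)
  have bd: "\<bar>y' (P x)\<bar> \<le> z' (P x)" "\<bar>y' (Q x)\<bar> \<le> z' (Q x)"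
    if "x \<in> prod_carrier M E" "\<forall>i\<in>M. rle (E i) (rzero (E i)) (x i)" for x
    using that P Q by (auto simp: positive_multilinear_def multilinear_def intro!: yz)
  have Ax: "y' (A x) = y' (P x) - y' (Q x)" if "x \<in> prod_carrier M E" for x
    using that P Q lin unfolding APQ[OF that] rminus_def
    by (intro F.lin_diff) (auto simp: positive_multilinear_def multilinear_def)
  have "\<bar>y' (A x)\<bar> \<le> pos_form z' x" "\<bar>pos_form y' x\<bar> \<le> pos_form z' x"
    if "x \<in> prod_carrier M E" "\<forall>i\<in>M. rle (E i) (rzero (E i)) (x i)" for x
    using bd[OF that] Ax[OF that(1)] unfolding pos_form_def by linarith+
  then show "dominated_form M E (\<lambda>x. y' (A x)) (pos_form z')"
    "dominated_form M E (pos_form y') (pos_form z')"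
    unfolding dominated_form_def using multilinear_compose[OF A lin(1)] pf lin by auto
qed

lemma form_dominated_abs:
  assumes "y' \<in> dualF"
  shows "dominated_form M E (\<lambda>x. y' (A x)) (pos_form (rabs (order_dual F) y'))"
    and "dominated_form M E (pos_form y') (pos_form (rabs (order_dual F) y'))"
  using assms by (auto intro!: form_dominated F.dual_abs_closed F.dual_abs_ge)

text \<open>The value of the limit over the indices in js, with the outer variables frozen at a: for
  empty js it is J(A a), and at the end it is the Arens extension. The parameter \<beta> allows the
  majorants to be treated alongside A.\<close>

definition iter_functional ::
    "(('b \<Rightarrow> real) \<Rightarrow> (nat \<Rightarrow> 'a) \<Rightarrow> real) \<Rightarrow> (nat \<Rightarrow> ('a \<Rightarrow> real) \<Rightarrow> real) \<Rightarrow> nat list \<Rightarrow>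
     (nat \<Rightarrow> 'a) \<Rightarrow> ('b \<Rightarrow> real) \<Rightarrow> real" where
  "iter_functional \<beta> v js a = (\<lambda>y'\<in>dualF. iter_apply E v js (\<beta> y') a)"

abbreviation "A_form \<equiv> \<lambda>y' x. y' (A x)"

lemma iter_functional_lin:
  assumes js: "distinct js" "set js \<subseteq> M" and a: "a \<in> prod_carrier (M - set js) E"
    and v: "\<And>j. j \<in> set js \<Longrightarrow> v j \<in> rcarrier (order_bidual (E j))"
    and dom: "\<And>y'. y' \<in> dualF \<Longrightarrow> dominated_form M E (\<beta> y') (pos_form (rabs (order_dual F) y'))"
    and add: "\<And>y' z' x. \<lbrakk>y' \<in> dualF; z' \<in> dualF; x \<in> prod_carrier M E\<rbrakk> \<Longrightarrow>
        \<beta> (radd (order_dual F) y' z') x = \<beta> y' x + \<beta> z' x"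
    and scale: "\<And>c y' x. \<lbrakk>y' \<in> dualF; x \<in> prod_carrier M E\<rbrakk> \<Longrightarrow>
        \<beta> (rscale (order_dual F) c y') x = c * \<beta> y' x"
  shows "linear_functional (order_dual F) (iter_functional \<beta> v js a)"
proof -
  have M: "M - set js \<union> set js = M" using js by blast
  have comb: "iter_apply E v js B'' a = iter_apply E v js (\<beta> y') a + c * iter_apply E v js (\<beta> z') a"
    if "y' \<in> dualF" "z' \<in> dualF" "\<And>x. x \<in> prod_carrier M E \<Longrightarrow> B'' x = \<beta> y' x + c * \<beta> z' x"
    for B'' y' z' c
    by (rule iter_apply_combine[OF _ _ js(1) _ _ _ v _ a, unfolded M])
      (use that fin riesz dom in auto)
  show ?thesis
    unfolding linear_functional_def
  proof (intro conjI ballI allI)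
    fix y' z' assume yz: "y' \<in> dualF" "z' \<in> dualF"
    then show "iter_functional \<beta> v js a (radd (order_dual F) y' z') =
        iter_functional \<beta> v js a y' + iter_functional \<beta> v js a z'"
      using comb[OF yz, of _ 1] add[OF yz] by (simp add: iter_functional_def F.dual_add_closed)
  next
    fix c y' assume y: "y' \<in> dualF"
    \<comment> \<open>A multiple by c is written as the form plus c - 1 times itself, which fits
      \<open>comb\<close>.\<close>
    have "iter_apply E v js (\<beta> (rscale (order_dual F) c y')) a =
        iter_apply E v js (\<beta> y') a + (c - 1) * iter_apply E v js (\<beta> y') a"
      using scale[OF y] by (intro comb[OF y y]) (simp add: algebra_simps)
    then show "iter_functional \<beta> v js a (rscale (order_dual F) c y') = c * iter_functional \<beta> v js a y'"
      using y by (simp add: iter_functional_def F.dual_scale_closed algebra_simps)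
  qed
qed

lemma iter_functional_bidual:
  assumes js: "distinct js" "set js \<subseteq> M" and a: "a \<in> prod_carrier (M - set js) E"
    and vw: "\<And>j. j \<in> set js \<Longrightarrow> bidual_dominated (E j) (v j) (w j)"
  defines "e \<equiv> abs_tuple (M - set js) E a"
  shows "iter_functional A_form v js a \<in> rcarrier (order_bidual F)"
    and "iter_functional pos_form w js e \<in> rcarrier (order_bidual F)"
    and "\<lbrakk>y' \<in> dualF; \<And>s. \<lbrakk>s \<in> F.C; rle F (rzero F) s\<rbrakk> \<Longrightarrow> 0 \<le> y' s\<rbrakk> \<Longrightarrow>
      \<bar>iter_functional A_form v js a y'\<bar> \<le> iter_functional pos_form w js e y'"
proof -
  interpret DF: riesz_space "order_dual F" by (rule F.riesz_space_dual)
  have M: "M - set js \<union> set js = M" using js by blast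
  have vC: "v j \<in> rcarrier (order_bidual (E j))" "w j \<in> rcarrier (order_bidual (E j))" if "j \<in> set js" for j
    using vw[OF that] by (auto simp: bidual_dominated_def)
  have e: "e \<in> prod_carrier (M - set js) E"
    unfolding e_def using riesz by (intro abs_tuple_bound a) auto
  show bd: "\<bar>iter_functional A_form v js a y'\<bar> \<le> iter_functional pos_form w js e y'"
    if y: "y' \<in> dualF" "\<And>s. \<lbrakk>s \<in> F.C; rle F (rzero F) s\<rbrakk> \<Longrightarrow> 0 \<le> y' s" for y'
  proof -
    have "dominated_form M E (A_form y') (pos_form y')"
      using y by (intro form_dominated) auto
    then have "dominated_form (M - set js) E (iter_apply E v js (A_form y')) (iter_apply E w js (pos_form y'))"
      using fin riesz js vw M by (intro dominated_form_iter_apply) auto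
    then have "\<bar>iter_apply E v js (A_form y') a\<bar> \<le> iter_apply E w js (pos_form y') e"
      unfolding e_def using fin riesz a by (intro dominated_form_abs) auto
    then show ?thesis using y by (simp add: iter_functional_def)
  qed
  have linA: "linear_functional (order_dual F) (iter_functional A_form v js a)"
    using A by (intro iter_functional_lin js a vC form_dominated_abs) (auto simp: dual_ops multilinear_def)
  have linP: "linear_functional (order_dual F) (iter_functional pos_form w js e)"
    using P Q by (intro iter_functional_lin js e vC form_dominated_abs)
      (auto simp: dual_ops multilinear_def positive_multilinear_def pos_form_def algebra_simps)
  show "iter_functional A_form v js a \<in> rcarrier (order_bidual F)"
    using bd by (intro DF.dualI[OF _ linA linP]) (auto simp: iter_functional_def F.dual_nonneg)
  show "iter_functional pos_form w js e \<in> rcarrier (order_bidual F)"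
    using order_trans[OF abs_ge_zero bd]
    by (intro DF.dual_posI[OF _ linP]) (auto simp: iter_functional_def F.dual_nonneg)
qed

lemma dist_estimate:
  assumes js: "distinct (j # js)" "set (j # js) \<subseteq> M"
    and b: "b \<in> prod_carrier (M - set (j # js)) E"
    and u: "\<And>k. k \<in> set (j # js) \<Longrightarrow> u k \<in> rcarrier (order_bidual (E k))"
    and \<phi>: "\<phi> \<in> dualF" "\<And>s. \<lbrakk>s \<in> F.C; rle F (rzero F) s\<rbrakk> \<Longrightarrow> 0 \<le> \<phi> s"
  obtains \<psi> where "\<psi> \<in> rcarrier (order_dual (E j))"
    "\<And>t. \<lbrakk>t \<in> rcarrier (E j); rle (E j) (rzero (E j)) t\<rbrakk> \<Longrightarrow> 0 \<le> \<psi> t"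
    "\<And>t. t \<in> rcarrier (E j) \<Longrightarrow>
       F.bidual_dist (iter_functional A_form u js (b(j := t))) (iter_functional A_form u (j # js) b) \<phi>
         \<le> riesz_space.bidual_dist (E j) (canonical (E j) t) (u j) \<psi>"
proof -
  let ?K = "M - set (j # js)" and ?abs = "\<lambda>j. rabs (order_bidual (E j))"
  interpret Ej: riesz_space "E j" using riesz js by auto
  define e where "e = abs_tuple ?K E b"
  have EK: "riesz_space (E i)" if "i \<in> ?K" for i using riesz that by blast
  have e: "e \<in> prod_carrier ?K E" "\<And>i. i \<in> ?K \<Longrightarrow> rle (E i) (rzero (E i)) (e i)"
    unfolding e_def using abs_tuple_bound[OF EK b] by auto
  have uabs: "bidual_dominated (E k) (u k) (?abs k (u k))" if "k \<in> set (j # js)" for k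
    using that js riesz u by (intro bidual_dominated_abs) auto
  let ?\<Phi> = "iter_apply E (\<lambda>k. ?abs k (u k)) js (pos_form \<phi>)"
  define \<psi> where "\<psi> = (\<lambda>t\<in>Ej.C. ?\<Phi> (e(j := t)))"
  have ins: "insert j ?K \<union> set js = M" using js by auto
  have "dominated_form M E (pos_form \<phi>) (pos_form \<phi>)" using \<phi> by (intro form_dominated) auto
  then have dom: "dominated_form (insert j ?K) E ?\<Phi> ?\<Phi>"
    using js fin riesz bidual_dominated_self[OF uabs] ins
    by (intro dominated_form_iter_apply) auto
  have \<psi>: "\<psi> \<in> rcarrier (order_dual (E j))"
    unfolding \<psi>_def using fin js riesz e dom by (intro dominated_section) auto
  have \<psi>0: "0 \<le> \<psi> t" if "t \<in> Ej.C" "rle (E j) (rzero (E j)) t" for t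
  proof -
    have "\<bar>?\<Phi> (e(j := t))\<bar> \<le> ?\<Phi> (e(j := t))"
      using dom upd_prod_carrier[OF e(1) that(1)] e(2) that(2) unfolding dominated_form_def by auto
    then show ?thesis using that by (simp add: \<psi>_def)
  qed
  show thesis
  proof (rule that[OF \<psi> \<psi>0])
    fix t assume t: "t \<in> Ej.C"
    define d where "d = rminus (order_bidual (E j)) (canonical (E j) t) (u j)"
    have d: "d \<in> rcarrier (order_bidual (E j))"
      "\<And>f. f \<in> rcarrier (order_dual (E j)) \<Longrightarrow> d f = f t - u j f"
      unfolding d_def using Ej.bidual_minus[OF Ej.canonical_closed[OF t], of "u j"] u
      by (auto simp: canonical_def)
    \<comment> \<open>Only the entry at j changes, and j is not in js, so the inner applications
      stay the same (\<open>vjs\<close>).\<close>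
    let ?v = "u(j := d)" and ?w = "(\<lambda>k. ?abs k (u k))(j := ?abs j d)"
    have vw: "bidual_dominated (E k) (?v k) (?w k)" if "k \<in> set (j # js)" for k
      using uabs[OF that] bidual_dominated_abs[OF Ej.riesz_space_axioms d(1)] by auto
    have vjs: "iter_apply E ?v js B = iter_apply E u js B"
      "iter_apply E ?w js B = iter_apply E (\<lambda>k. ?abs k (u k)) js B" for B
      using js by (auto intro: iter_apply_cong)
    have bt: "b(j := t) \<in> prod_carrier (M - set js) E"
    proof -
      have "insert j ?K = M - set js" using js by auto
      then show ?thesis using upd_prod_carrier[OF b t] by simp
    qed
    have C: "iter_functional A_form u js (b(j := t)) \<in> rcarrier (order_bidual F)"
      "iter_functional A_form u (j # js) b \<in> rcarrier (order_bidual F)"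
      "iter_functional A_form ?v (j # js) b \<in> rcarrier (order_bidual F)"
      "iter_functional pos_form ?w (j # js) e \<in> rcarrier (order_bidual F)"
    proof -
      show "iter_functional A_form u js (b(j := t)) \<in> rcarrier (order_bidual F)"
        by (rule iter_functional_bidual(1)[OF _ _ bt uabs]) (use js in auto)
      show "iter_functional A_form u (j # js) b \<in> rcarrier (order_bidual F)"
        by (rule iter_functional_bidual(1)[OF js b uabs])
      show "iter_functional A_form ?v (j # js) b \<in> rcarrier (order_bidual F)"
        by (rule iter_functional_bidual(1)[OF js b vw])
      show "iter_functional pos_form ?w (j # js) e \<in> rcarrier (order_bidual F)"
        unfolding e_def by (rule iter_functional_bidual(2)[OF js b vw])
    qed
    have eq: "rminus (order_bidual F) (iter_functional A_form u js (b(j := t)))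
        (iter_functional A_form u (j # js) b) = iter_functional A_form ?v (j # js) b"
      (is "?l = ?r")
    proof (rule extensionalityI[of _ dualF])
      show "?l \<in> extensional dualF" "?r \<in> extensional dualF"
        using F.bidual_minus(1)[OF C(1,2)] C(3) by (auto simp: dual_carrier)
      fix y' assume y: "y' \<in> dualF"
      have "dominated_form (insert j ?K) E (iter_apply E u js (A_form y'))
          (iter_apply E (\<lambda>k. ?abs k (u k)) js (pos_form (rabs (order_dual F) y')))"
        using js fin riesz uabs form_dominated_abs[OF y] ins by (intro dominated_form_iter_apply) auto
      then have "(\<lambda>t\<in>Ej.C. iter_apply E u js (A_form y') (b(j := t))) \<in> rcarrier (order_dual (E j))"
        using fin js riesz b by (intro dominated_section) auto
      then show "?l y' = ?r y'"
        using y t d(2) F.bidual_minus(2)[OF C(1,2) y] by (simp add: iter_functional_def papply_def vjs)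
    qed
    have "F.bidual_dist (iter_functional A_form u js (b(j := t))) (iter_functional A_form u (j # js) b) \<phi>
        \<le> iter_functional pos_form ?w (j # js) e \<phi>"
      unfolding F.bidual_dist_def eq
      by (rule F.bidual_abs_le[OF C(3,4) _ \<phi>])
        (unfold e_def, rule iter_functional_bidual(3)[OF js b vw])
    also have "\<dots> = Ej.bidual_dist (canonical (E j) t) (u j) \<psi>"
      unfolding Ej.bidual_dist_def d_def[symmetric]
      using \<phi> by (simp add: iter_functional_def papply_def vjs \<psi>_def)
    finally show "F.bidual_dist (iter_functional A_form u js (b(j := t)))
        (iter_functional A_form u (j # js) b) \<phi> \<le> Ej.bidual_dist (canonical (E j) t) (u j) \<psi>" .
  qed
qed

text \<open>Each limit concerns one variable and follows from \<open>dist_estimate\<close>. The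
  indices a are arbitrary in the induction, because the inner limits must exist for every choice of
  the outer indices.\<close>

lemma iterated_limit_iter_functional:
  assumes js: "distinct js" "set js \<subseteq> M"
    and u: "\<And>k. k \<in> M \<Longrightarrow> u k \<in> rcarrier (order_bidual (E k))"
    and x: "\<And>k \<alpha>. \<lbrakk>k \<in> M; \<alpha> \<in> D k\<rbrakk> \<Longrightarrow> x k \<alpha> \<in> rcarrier (E k)"
    and lim: "\<And>k. k \<in> M \<Longrightarrow>
      limitin (abs_weak_topology (E k)) (\<lambda>\<alpha>. canonical (E k) (x k \<alpha>)) (u k) (tail_filter (D k) (le k))"
    and D: "\<And>k. k \<in> M \<Longrightarrow> eventually (\<lambda>\<alpha>. \<alpha> \<in> D k) (tail_filter (D k) (le k))"
    and a: "\<And>k. k \<in> M - set js \<Longrightarrow> a k \<in> D k"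
  shows "iterated_limit (abs_weak_topology F) D le js (\<lambda>\<alpha>. canonical F (A (\<lambda>k\<in>M. x k (\<alpha> k)))) a
     (iter_functional A_form u js (\<lambda>k\<in>M - set js. x k (a k)))"
  using js a
proof (induction js arbitrary: a)
  case Nil
  then show ?case by (auto simp: iter_functional_def canonical_def)
next
  case (Cons j js)
  let ?K = "M - set (j # js)"
  define b where "b = (\<lambda>k\<in>?K. x k (a k))"
  have j: "j \<in> M" using Cons.prems by simp
  have b: "b \<in> prod_carrier ?K E" unfolding b_def using x Cons.prems(3) by auto
  have uabs: "bidual_dominated (E k) (u k) (rabs (order_bidual (E k)) (u k))" if "k \<in> M" for k
    using that riesz u by (intro bidual_dominated_abs) auto
  have upd: "(\<lambda>k\<in>M - set js. x k ((a(j := \<alpha>)) k)) = b(j := x j \<alpha>)" for \<alpha>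
    using Cons.prems(1,2) by (auto simp: b_def fun_eq_iff)
  have ins: "insert j ?K = M - set js" using Cons.prems(1,2) by auto
  define h where "h \<alpha> = iter_functional A_form u js (b(j := x j \<alpha>))" for \<alpha>
  have hC: "h \<alpha> \<in> rcarrier (order_bidual F)" if "\<alpha> \<in> D j" for \<alpha>
    unfolding h_def
    by (rule iter_functional_bidual(1)[OF _ _ _ uabs])
      (use Cons.prems upd_prod_carrier[OF b x[OF j that]] ins in auto)
  have lC: "iter_functional A_form u (j # js) b \<in> rcarrier (order_bidual F)"
    by (rule iter_functional_bidual(1)[OF _ _ b uabs]) (use Cons.prems in auto)
  have "limitin (abs_weak_topology F) h (iter_functional A_form u (j # js) b) (tail_filter (D j) (le j))"
    unfolding F.limitin_abs_weak
  proof (intro conjI ballI allI impI lC)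
    fix \<phi> and \<epsilon> :: real assume \<phi>: "\<phi> \<in> dualF" and \<epsilon>: "0 < \<epsilon>"
    interpret Ej: riesz_space "E j" using riesz j by blast
    obtain \<psi> where \<psi>: "\<psi> \<in> rcarrier (order_dual (E j))"
      "\<And>t. \<lbrakk>t \<in> Ej.C; rle (E j) (rzero (E j)) t\<rbrakk> \<Longrightarrow> 0 \<le> \<psi> t"
      "\<And>t. t \<in> Ej.C \<Longrightarrow>
       F.bidual_dist (iter_functional A_form u js (b(j := t))) (iter_functional A_form u (j # js) b)
         (rabs (order_dual F) \<phi>) \<le> Ej.bidual_dist (canonical (E j) t) (u j) \<psi>"
      using dist_estimate[OF Cons.prems(1,2) b _ F.dual_abs_closed[OF \<phi>] F.dual_abs_nonneg[OF \<phi>], of u]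
        u Cons.prems(2) by blast
    \<comment> \<open>The topology supplies smallness at |\<psi>|, which is \<psi> itself by
      positivity.\<close>
    have "eventually (\<lambda>\<alpha>. Ej.bidual_dist (canonical (E j) (x j \<alpha>)) (u j) (rabs (order_dual (E j)) \<psi>) < \<epsilon>)
        (tail_filter (D j) (le j))"
      using lim[OF j] \<psi>(1) \<epsilon> unfolding Ej.limitin_abs_weak by (fast elim: eventually_mono)
    then show "eventually (\<lambda>\<alpha>. h \<alpha> \<in> rcarrier (order_bidual F) \<and>
        F.bidual_dist (h \<alpha>) (iter_functional A_form u (j # js) b) (rabs (order_dual F) \<phi>) < \<epsilon>)
        (tail_filter (D j) (le j))"
      using D[OF j]
    proof eventually_elim
      case (elim \<alpha>)
      then show ?case
        using hC \<psi>(3)[OF x[OF j]] Ej.dual_abs_eq[OF \<psi>(1,2)] by (fastforce simp: h_def)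
    qed
  qed
  moreover have "iterated_limit (abs_weak_topology F) D le js
      (\<lambda>\<alpha>. canonical F (A (\<lambda>k\<in>M. x k (\<alpha> k)))) (a(j := \<alpha>)) (h \<alpha>)" if "\<alpha> \<in> D j" for \<alpha>
    unfolding h_def upd[symmetric] using Cons.prems that by (intro Cons.IH) auto
  ultimately show ?case unfolding iterated_limit.simps b_def by blast
qed

end

section \<open>Arens extensions\<close>

text \<open>\<open>arens_comp\<close> puts each new functional outside, whereas the head of the list
  is outermost in \<open>iter_apply\<close>; hence the reversed list. Regularity of each
  intermediate form is established as well, since \<open>arens_bar\<close> yields its intended value
  only on \<open>regular_forms\<close>.\<close>

lemma arens_comp_iter_apply:
  assumes E: "\<And>i. i \<in> {1..m} \<Longrightarrow> riesz_space (E i)" and \<rho>: "\<rho> permutes {1..m}"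
    and u: "\<And>k. k \<in> {1..m} \<Longrightarrow> u k \<in> rcarrier (order_bidual (E k))"
    and BP: "dominated_form {1..m} E B P" and ext: "B \<in> extensional (prod_carrier {1..m} E)"
    and "k \<le> m"
  shows "arens_comp E m \<rho> u k B \<in> regular_forms (arens_index m \<rho> k) E"
    and "\<And>x. x \<in> prod_carrier (arens_index m \<rho> k) E \<Longrightarrow>
      arens_comp E m \<rho> u k B x = iter_apply E u (rev (map \<rho> [1..<Suc k])) B x"
proof -
  let ?I = "arens_index m \<rho>" and ?js = "\<lambda>k. rev (map \<rho> [1..<Suc k])"
  let ?w = "\<lambda>j. rabs (order_bidual (E j)) (u j)"
  have img: "set (?js k) = \<rho> ` {1..k}" for k by (auto simp del: upt_Suc)
  have dist: "distinct (?js k)" for k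
    using permutes_inj[OF \<rho>] by (auto simp: distinct_map inj_on_def dest: injD simp del: upt_Suc)
  have \<rho>M: "\<rho> i \<in> {1..m}" if "i \<in> {1..m}" for i
    using that permutes_in_image[OF \<rho>] by blast
  have sub: "set (?js k) \<subseteq> {1..m}" if "k \<le> m" for k
    unfolding img using \<rho>M that by (auto intro!: image_subsetI)
  have reg: "restrict (iter_apply E u (?js k) B) (prod_carrier (?I k) E) \<in> regular_forms (?I k) E"
    if "k \<le> m" for k
  proof -
    have un: "?I k \<union> set (?js k) = {1..m}"
      using sub[OF that] unfolding img arens_index_def by blast
    have EI: "riesz_space (E i)" if "i \<in> ?I k" for i using that E by (auto simp: arens_index_def)
    have fin: "finite (?I k)" by (simp add: arens_index_def)
    have "dominated_form (?I k) E (iter_apply E u (?js k) B) (iter_apply E ?w (?js k) P)"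
    proof (rule dominated_form_iter_apply[OF fin _ dist])
      show "set (?js k) \<inter> ?I k = {}" unfolding img arens_index_def by blast
      show "dominated_form (?I k \<union> set (?js k)) E B P" unfolding un by (rule BP)
      show "bidual_dominated (E j) (u j) (?w j)" if "j \<in> set (?js k)" for j
        using that sub[OF \<open>k \<le> m\<close>] E u by (blast intro: bidual_dominated_abs)
    qed (use E un in blast)
    then have "dominated_form (?I k) E (restrict (iter_apply E u (?js k) B) (prod_carrier (?I k) E))
        (iter_apply E ?w (?js k) P)"
      by (rule dominated_form_cong[rotated 2]) (use EI in auto)
    then show ?thesis unfolding regular_forms_def using regular_if_dominated_form by auto
  qed
  have main: "arens_comp E m \<rho> u k B = restrict (iter_apply E u (?js k) B) (prod_carrier (?I k) E)"
    if "k \<le> m" for k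
    using that
  proof (induction k)
    \<comment> \<open>No functional has acted and no index is removed; restricting B to the full
      product changes nothing by extensionality.\<close>
    case 0
    show ?case using ext by (simp add: arens_index_def extensional_restrict)
  next
    case (Suc k)
    let ?j = "\<rho> (Suc k)"
    have "?j \<notin> \<rho> ` {1..k}" using permutes_inj[OF \<rho>] by (auto simp: inj_eq)
    moreover have "{1..Suc k} = insert (Suc k) {1..k}" by auto
    ultimately have ins: "insert ?j (?I (Suc k)) = ?I k"
      using \<rho>M[of "Suc k"] Suc.prems by (auto simp: arens_index_def)
    define B\<^sub>k where "B\<^sub>k = restrict (iter_apply E u (?js k) B) (prod_carrier (?I k) E)"
    have B\<^sub>k: "arens_comp E m \<rho> u k B = B\<^sub>k" "B\<^sub>k \<in> regular_forms (?I k) E"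
      using Suc.IH Suc.prems reg[of k] unfolding B\<^sub>k_def by (metis Suc_leD)+
    have js: "?js (Suc k) = ?j # ?js k" by (simp add: upt_Suc_append)
    have "arens_comp E m \<rho> u (Suc k) B x =
        restrict (iter_apply E u (?js (Suc k)) B) (prod_carrier (?I (Suc k)) E) x" for x
    proof (cases "x \<in> prod_carrier (?I (Suc k)) E")
      case True
      have "x(?j := t) \<in> prod_carrier (?I k) E" if "t \<in> rcarrier (E ?j)" for t
        using upd_prod_carrier[OF True that] unfolding ins .
      then have "(\<lambda>t\<in>rcarrier (E ?j). B\<^sub>k (x(?j := t)))
          = (\<lambda>t\<in>rcarrier (E ?j). iter_apply E u (?js k) B (x(?j := t)))"
        by (auto simp: B\<^sub>k_def simp del: upt_Suc)
      then show ?thesis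
        using B\<^sub>k True unfolding js by (simp add: arens_bar_def papply_def del: upt_Suc)
    qed (use B\<^sub>k in \<open>simp add: arens_bar_def del: upt_Suc\<close>)
    then show ?case ..
  qed
  show "arens_comp E m \<rho> u k B \<in> regular_forms (?I k) E" using main reg \<open>k \<le> m\<close> by simp
  show "arens_comp E m \<rho> u k B x = iter_apply E u (?js k) B x"
    if "x \<in> prod_carrier (?I k) E" for x using main[OF \<open>k \<le> m\<close>] that by simp
qed

section \<open>Tail filters of nets, and the final assembly\<close>

lemma eventually_tail_filter:
  assumes "directed_set D le"
  shows "eventually Q (tail_filter D le) \<longleftrightarrow> (\<exists>d\<in>D. \<forall>e\<in>D. le d e \<longrightarrow> Q e)"
  unfolding tail_filter_def
proof (subst eventually_INF_base)
  fix a b assume ab: "a \<in> D" "b \<in> D"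
  then obtain c where c: "c \<in> D" "le a c" "le b c" using assms unfolding directed_set_def by blast
  then have "{e \<in> D. le c e} \<subseteq> {e \<in> D. le a e} \<inter> {e \<in> D. le b e}"
    using assms ab unfolding directed_set_def by blast
  then show "\<exists>c\<in>D. principal {e \<in> D. le c e} \<le> inf (principal {e \<in> D. le a e}) (principal {e \<in> D. le b e})"
    using c(1) by auto
next
  show "D \<noteq> {}" using assms unfolding directed_set_def by blast
qed (auto simp: eventually_principal)

text \<open>A positive functional equals its modulus, so convergence gives an index whose tail is
  close to v; by reflexivity the index itself belongs to that tail.\<close>

lemma approximable_if_limit:
  assumes R: "riesz_space R" and D: "directed_set D le"
    and x: "\<And>\<alpha>. \<alpha> \<in> D \<Longrightarrow> x \<alpha> \<in> rcarrier R"
    and lim: "limitin (abs_weak_topology R) (\<lambda>\<alpha>. canonical R (x \<alpha>)) v (tail_filter D le)"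
  shows "approximable R v"
proof -
  interpret riesz_space R by (fact R)
  have "\<exists>t\<in>C. bidual_dist (canonical R t) v \<phi> < \<epsilon>"
    if \<phi>: "\<phi> \<in> rcarrier (order_dual R)" "\<forall>x\<in>C. \<zero> \<preceq> x \<longrightarrow> 0 \<le> \<phi> x" and \<epsilon>: "0 < \<epsilon>" for \<phi> \<epsilon>
  proof -
    have "eventually (\<lambda>\<alpha>. bidual_dist (canonical R (x \<alpha>)) v (rabs (order_dual R) \<phi>) < \<epsilon>) (tail_filter D le)"
      using lim \<phi>(1) \<epsilon> unfolding limitin_abs_weak by (fast elim: eventually_mono)
    moreover have "rabs (order_dual R) \<phi> = \<phi>" using \<phi> by (intro dual_abs_eq) auto
    ultimately obtain d where "d \<in> D" "\<And>e. \<lbrakk>e \<in> D; le d e\<rbrakk> \<Longrightarrow> bidual_dist (canonical R (x e)) v \<phi> < \<epsilon>"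
      unfolding eventually_tail_filter[OF D] by auto
    then show ?thesis using D x unfolding directed_set_def by blast
  qed
  then show ?thesis using lim unfolding approximable_def limitin_abs_weak by blast
qed

theorem proposition2p5:
  fixes m :: nat
    and E :: "nat \<Rightarrow> 'a riesz"
    and F :: "'b riesz"
    and \<rho> :: "nat \<Rightarrow> nat"
    and A :: "(nat \<Rightarrow> 'a) \<Rightarrow> 'b"
    and x'' :: "nat \<Rightarrow> ('a \<Rightarrow> real) \<Rightarrow> real"
    and D :: "nat \<Rightarrow> 'i set"
    and le :: "nat \<Rightarrow> 'i \<Rightarrow> 'i \<Rightarrow> bool"
    and x :: "nat \<Rightarrow> 'i \<Rightarrow> 'a"
  assumes "1 \<le> m"
    and "\<And>k. k \<in> {1..m} \<Longrightarrow> riesz_space (E k)"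
    and "\<And>k. k \<in> {1..m} \<Longrightarrow> archimedean (E k)"
    and "riesz_space F"
    and "\<rho> permutes {1..m}"
    and "regular_multilinear {1..m} E F A"
    and "\<And>k. k \<in> {1..m} \<Longrightarrow> x'' k \<in> order_cont_dual (order_dual (E k))"
    and "\<And>k. k \<in> {1..m} \<Longrightarrow> directed_set (D k) (le k)"
    and "\<And>k \<alpha>. k \<in> {1..m} \<Longrightarrow> \<alpha> \<in> D k \<Longrightarrow> x k \<alpha> \<in> rcarrier (E k)"
    and "\<And>k. k \<in> {1..m} \<Longrightarrow>
           limitin (subtopology (abs_weak_topology (E k)) (order_cont_dual (order_dual (E k))))
             (\<lambda>\<alpha>. canonical (E k) (x k \<alpha>)) (x'' k) (tail_filter (D k) (le k))"
  shows "iterated_limit (abs_weak_topology F) D le (map \<rho> [1..<Suc m])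
           (\<lambda>\<alpha>. canonical F (A (\<lambda>k\<in>{1..m}. x k (\<alpha> k)))) (\<lambda>_. undefined)
           (arens_ext E F m \<rho> A (\<lambda>k\<in>{1..m}. x'' k))"
proof -
  let ?M = "{1..m}"
  define js where "js = map \<rho> [1..<Suc m]"
  define u where "u = (\<lambda>k\<in>?M. x'' k)"
  note E = assms(2) and \<rho> = assms(5) and D = assms(8) and x = assms(9)
  have uo: "u k \<in> order_cont_dual (order_dual (E k))" if "k \<in> ?M" for k
    using assms(7)[OF that] that by (simp add: u_def)
  have lim: "limitin (abs_weak_topology (E k)) (\<lambda>\<alpha>. canonical (E k) (x k \<alpha>)) (u k) (tail_filter (D k) (le k))"
    if "k \<in> ?M" for k
    using assms(10)[OF that] that by (simp add: u_def limitin_subtopology)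
  have uC: "u k \<in> rcarrier (order_bidual (E k))" if "k \<in> ?M" for k
    using uo[OF that] by (simp add: order_cont_dual_def)
  have ua: "approximable (E k) (u k)" if "k \<in> ?M" for k
    using E[OF that] D[OF that] x[OF that] lim[OF that] by (rule approximable_if_limit)
  obtain P Q where PQ: "positive_multilinear ?M E F P" "positive_multilinear ?M E F Q"
    "\<And>x. x \<in> prod_carrier ?M E \<Longrightarrow> A x = rminus F (P x) (Q x)" and A: "multilinear ?M E F A"
    using assms(6) unfolding regular_multilinear_def by blast
  interpret regular_operator F ?M E A P Q
    using assms(4) E PQ A by (intro regular_operator.intro regular_operator_axioms.intro) auto
  have set: "set js = ?M"
    unfolding js_def using permutes_image[OF \<rho>] by (simp add: atLeastLessThanSuc_atLeastAtMost del: upt_Suc)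
  have dist: "distinct js"
    unfolding js_def using permutes_inj[OF \<rho>] by (auto simp: distinct_map inj_on_def dest: injD simp del: upt_Suc)
  have index: "arens_index m \<rho> m = {}"
    using permutes_image[OF \<rho>] by (simp add: arens_index_def)
  have "arens_ext E F m \<rho> A u = iter_functional A_form u js (\<lambda>_. undefined)"
  proof -
    have "arens_comp E m \<rho> u m (\<lambda>x\<in>prod_carrier ?M E. y' (A x)) (\<lambda>_. undefined) =
        iter_apply E u js (A_form y') (\<lambda>_. undefined)" if y: "y' \<in> dualF" for y'
    proof -
      let ?B = "\<lambda>x\<in>prod_carrier ?M E. y' (A x)" and ?P = "pos_form (rabs (order_dual F) y')"
      have B: "dominated_form ?M E ?B ?P"
        by (rule dominated_form_cong[OF E _ form_dominated_abs(1)[OF y]]) auto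
      have "arens_comp E m \<rho> u m ?B (\<lambda>_. undefined) = iter_apply E u (rev js) ?B (\<lambda>_. undefined)"
        unfolding js_def by (rule arens_comp_iter_apply(2)[OF E \<rho> uC B]) (auto simp: index)
      \<comment> \<open>Here the Arens order, in which \<rho>(1) acts first, becomes the order of
        the limits, in which \<rho>(1) acts last.\<close>
      also have "\<dots> = iter_apply E u js ?B (\<lambda>_. undefined)"
        by (rule iter_apply_rev[where K = "{}" and P = ?P])
          (use E dist B ua uo in \<open>auto simp: set\<close>)
      also have "\<dots> = iter_apply E u js (A_form y') (\<lambda>_. undefined)"
        by (rule iter_apply_form_cong[where K = "{}"]) (auto simp: set)
      finally show ?thesis .
    qed
    moreover have "u \<in> prod_carrier ?M (\<lambda>k. order_bidual (E k))"
      using uC by (auto simp: u_def)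
    ultimately show ?thesis by (auto simp: arens_ext_def iter_functional_def fun_eq_iff)
  qed
  also have "(\<lambda>_. undefined) = (\<lambda>k\<in>?M - set js. x k undefined)" unfolding set by auto
  finally have eq: "arens_ext E F m \<rho> A u =
      iter_functional A_form u js (\<lambda>k\<in>?M - set js. x k undefined)" .
  have ev: "eventually (\<lambda>\<alpha>. \<alpha> \<in> D k) (tail_filter (D k) (le k))" if "k \<in> ?M" for k
    using D[OF that] unfolding eventually_tail_filter[OF D[OF that]] directed_set_def by blast
  show ?thesis
    unfolding u_def[symmetric] js_def[symmetric] eq
    by (rule iterated_limit_iter_functional[OF dist _ uC x lim ev]) (simp_all add: set)
qed

end
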